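(* Let $H$ be a graph. There is a constant $c_H=2^{O(|H|\sqrt{\log|H|})}$ such that the following holds. Let $(D,r)$ be a rooted digraph whose underlying undirected graph is $H$-minor-free and which is reduced with respect to Rules 1–6. If $\mathrm{maxleaf}(D)<k$, then $|V(D)|\le c_H\cdot k$.
   Context: A rooted digraph $(D,r)$ is a finite digraph without loops or parallel arcs (arcs $(u,v)$ and $(v,u)$ may both be present) with a root $r$ of in-degree $0$. An outbranching rooted at $r$ is a spanning subgraph of $D$ whose underlying undirected graph is a tree with arcs oriented away from $r$; its leaves are vertices of out-degree $0$ in it; $\mathrm{maxleaf}(D)$ is the maximum number of leaves of such an outbranching. A cut-vertex is a vertex $v\ne r$ such that some vertex is unreachable from $r$ in $D-v$. A cut-edge is an arc $e$ such that some vertex is unreachable from $r$ in $D-e$. $N^-(x)$, $N^+(x)$ denote the in- and out-neighbourhoods of $x$. $D$ is reduced with respect to Rules 1–6 if all of the following hold: (1) every vertex is reachable from $r$; (2) no cut-vertex has exactly one incoming arc and no cut-vertex has exactly one outgoing arc; (3) there are no vertices $u_1,\dots,u_5$ with $N^+(u_i)=N^-(u_i)=\{u_{i-1},u_{i+1}\}$ for $i=2,3,4$; (4) there is no vertex $x$ with an in-neighbour $y$ such that every directed path from $r$ to $y$ contains a vertex of $N^-(x)\setminus\{y\}$; (5) there are no two cut-edges $(x_1,y_1),(x_2,y_2)$ with $(x_1,x_2),(x_2,x_1)\in E(D)$; (6) there is no cut-edge $(u,v)$ with $(v,u)\in E(D)$. $|H|$ denotes the number of vertices of $H$. *)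

theory Defs
  imports Complex_Main "Graph_Theory.Graph_Theory"
begin

text \<open>
  An undirected graph is a symmetric digraph (\<^locale>\<open>pair_graph\<close>: finite and simple), and the
  underlying undirected graph of a digraph is its \<^const>\<open>mk_symmetric\<close>.
\<close>

definition rooted_digraph :: "'a pair_pre_digraph \<Rightarrow> 'a \<Rightarrow> bool" where
  "rooted_digraph D r \<longleftrightarrow> pair_digraph D \<and> r \<in> pverts D \<and> in_degree D r = 0"

definition in_nbrs :: "'a pair_pre_digraph \<Rightarrow> 'a \<Rightarrow> 'a set" where
  "in_nbrs D v = {u. (u, v) \<in> parcs D}"

definition out_nbrs :: "'a pair_pre_digraph \<Rightarrow> 'a \<Rightarrow> 'a set" where
  "out_nbrs D v = {w. (v, w) \<in> parcs D}"

text \<open>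
  Minors are given by branch sets. \<^const>\<open>Digraph_Component.connected\<close> includes that the vertex set
  is nonempty.
\<close>

definition is_minor :: "'h pair_pre_digraph \<Rightarrow> 'a pair_pre_digraph \<Rightarrow> bool" where
  "is_minor H G \<longleftrightarrow> (\<exists>B :: 'h \<Rightarrow> 'a set.
     (\<forall>x \<in> pverts H. B x \<subseteq> pverts G \<and> Digraph_Component.connected (with_proj G \<restriction> B x)) \<and>
     (\<forall>x \<in> pverts H. \<forall>y \<in> pverts H. x \<noteq> y \<longrightarrow> B x \<inter> B y = {}) \<and>
     (\<forall>(x, y) \<in> parcs H. \<exists>u \<in> B x. \<exists>v \<in> B y. (u, v) \<in> parcs G))"

text \<open>
  The predicate \<^const>\<open>tree\<close> forbids directed cycles only, and on a symmetric digraph it rejects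
  every edge \<open>uv\<close>, because \<open>u, v, u\<close> is a cycle in the sense of \<^const>\<open>pre_digraph.cycle\<close>.
  The cycles of an undirected graph are the cycles of length at least 3 of its symmetric digraph.
\<close>

definition underlying_tree :: "'a pair_pre_digraph \<Rightarrow> bool" where
  "underlying_tree T \<longleftrightarrow> Digraph_Component.connected T \<and>
     \<not> (\<exists>p. pre_digraph.cycle (mk_symmetric T) p \<and> length p \<ge> 3)"

text \<open>
  An arc \<open>(u, v)\<close> is oriented away from \<open>r\<close> if it is the last arc of the path from \<open>r\<close> to \<open>v\<close> in the
  underlying tree. Reachability of all vertices from \<open>r\<close> would be too weak here: it would
  allow \<open>T\<close> to contain an arc together with its reverse.
\<close>

definition outbranching :: "'a pair_pre_digraph \<Rightarrow> 'a \<Rightarrow> 'a pair_pre_digraph \<Rightarrow> bool" where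
  "outbranching D r T \<longleftrightarrow> spanning T D \<and> underlying_tree T \<and>
     (\<forall>(u, v) \<in> parcs T. \<exists>p. pre_digraph.apath (mk_symmetric T) r (p @ [(u, v)]) v)"

definition leaves :: "'a pair_pre_digraph \<Rightarrow> 'a set" where
  "leaves T = {v \<in> pverts T. out_degree T v = 0}"

text \<open>Meaningful only if \<open>D\<close> has an outbranching rooted at \<open>r\<close>; \<open>rule1\<close> below guarantees this.\<close>

definition maxleaf :: "'a pair_pre_digraph \<Rightarrow> 'a \<Rightarrow> nat" where
  "maxleaf D r = Max {card (leaves T) | T. outbranching D r T}"

definition cut_vertex :: "'a pair_pre_digraph \<Rightarrow> 'a \<Rightarrow> 'a \<Rightarrow> bool" where
  "cut_vertex D r v \<longleftrightarrow> v \<in> pverts D \<and> v \<noteq> r \<and>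
     (\<exists>w \<in> pverts D - {v}. \<not> r \<rightarrow>\<^sup>*\<^bsub>pre_digraph.del_vert D v\<^esub> w)"

definition cut_edge :: "'a pair_pre_digraph \<Rightarrow> 'a \<Rightarrow> 'a \<times> 'a \<Rightarrow> bool" where
  "cut_edge D r e \<longleftrightarrow> e \<in> parcs D \<and>
     (\<exists>w \<in> pverts D. \<not> r \<rightarrow>\<^sup>*\<^bsub>pre_digraph.del_arc D e\<^esub> w)"

definition rule1 :: "'a pair_pre_digraph \<Rightarrow> 'a \<Rightarrow> bool" where
  "rule1 D r \<longleftrightarrow> (\<forall>v \<in> pverts D. r \<rightarrow>\<^sup>*\<^bsub>D\<^esub> v)"

definition rule2 :: "'a pair_pre_digraph \<Rightarrow> 'a \<Rightarrow> bool" where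
  "rule2 D r \<longleftrightarrow> \<not> (\<exists>v. cut_vertex D r v \<and> (in_degree D v = 1 \<or> out_degree D v = 1))"

definition rule3 :: "'a pair_pre_digraph \<Rightarrow> bool" where
  "rule3 D \<longleftrightarrow> \<not> (\<exists>u :: nat \<Rightarrow> 'a. u ` {1..5} \<subseteq> pverts D \<and> inj_on u {1..5} \<and>
     (\<forall>i \<in> {2, 3, 4}. out_nbrs D (u i) = {u (i - 1), u (i + 1)} \<and>
                       in_nbrs D (u i) = {u (i - 1), u (i + 1)}))"

definition rule4 :: "'a pair_pre_digraph \<Rightarrow> 'a \<Rightarrow> bool" where
  "rule4 D r \<longleftrightarrow> \<not> (\<exists>x \<in> pverts D. \<exists>y \<in> in_nbrs D x. \<forall>p. pre_digraph.apath D r p y \<longrightarrow>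
     set (pre_digraph.awalk_verts D r p) \<inter> (in_nbrs D x - {y}) \<noteq> {})"

definition rule5 :: "'a pair_pre_digraph \<Rightarrow> 'a \<Rightarrow> bool" where
  "rule5 D r \<longleftrightarrow> \<not> (\<exists>x1 y1 x2 y2. cut_edge D r (x1, y1) \<and> cut_edge D r (x2, y2) \<and>
     (x1, x2) \<in> parcs D \<and> (x2, x1) \<in> parcs D)"

definition rule6 :: "'a pair_pre_digraph \<Rightarrow> 'a \<Rightarrow> bool" where
  "rule6 D r \<longleftrightarrow> \<not> (\<exists>u v. cut_edge D r (u, v) \<and> (v, u) \<in> parcs D)"

definition reduced :: "'a pair_pre_digraph \<Rightarrow> 'a \<Rightarrow> bool" where
  "reduced D r \<longleftrightarrow> rule1 D r \<and> rule2 D r \<and> rule3 D \<and> rule4 D r \<and> rule5 D r \<and> rule6 D r"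

end

(*
Write l for maxleaf. Choosing a parent for every vertex other than r, without creating a cycle, gives
  an outbranching, so at most l vertices are not chosen. In a reduced digraph every vertex either has
  its immediate dominator as only in-neighbour or has in-neighbours before and after it in a low-high
  order of the dominator tree. The earlier and the later in-neighbours give two spanning trees Tf and Tb
  running in opposite directions. Switching a third of the vertices of a suitable set to other parents
  would gain leaves, so up to O(l) exceptions every vertex has in-degree at most 2, has no sibling in
  Tf or Tb, and has its Tb-parent below it in Tf and vice versa. This forces the remaining vertices
  into O(l) chains of macro vertices (single vertices, or a cut-vertex with its unique dominated
  vertex) in which neighbours are joined in both directions; all other arcs leaving a chain end in the
  O(l) vertices of in-degree at least 3. By Rule 4 each such vertex has at most two in-neighbours on a
  chain, and by Rules 2 and 3 each five consecutive macro vertices have an arc to one of them.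
  Contracting the chains gives a minor with O(l) vertices, hence with at most 2^|H| O(l) edges by
  Mader's argument. The resulting constant is 2^O(|H|), so the Kostochka-Thomason density bound
  |H| sqrt(log |H|) is not required.
*)
theory Submission
  imports Defs "HOL-Library.List_Lexorder" "HOL-Library.Sublist"
begin

text \<open>Dominance is the intersection of two linear orders: the preorder of the dominator tree
  for some order of siblings, and the preorder with all siblings reversed. That a suitable order of
  siblings exists is an electrical-network argument. A harmonic function breaks ties between
  siblings, and Rule 4 with reachability ensures that each set of at least two siblings has the two
  boundary vertices which such a function needs. The linear orders also make the exchange of parents
  safe: new parents that are smaller in the same order cannot close a cycle, whichever vertices are
  switched. What remains is that a parent vacated by one switch may be taken up by another; this
  forces the factor 3 and, through it, most of the numerical constants. The minor found is complete
  on as many vertices as \<open>H\<close> has, so the edges of \<open>H\<close> never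
  matter.\<close>

section \<open>Low-high labellings\<close>

definition between_nbrs :: "('a \<Rightarrow> 'a set) \<Rightarrow> ('a \<Rightarrow> real) \<Rightarrow> 'a \<Rightarrow> bool" where
  "between_nbrs In h c \<longleftrightarrow> (\<exists>u \<in> In c. h u < h c) \<and> (\<exists>u \<in> In c. h c < h u)"

text \<open>The differences to the average sum to zero; if they all had one sign, each of them would
  vanish.\<close>

lemma between_nbrs_if_average:
  fixes g :: "'a \<Rightarrow> real"
  assumes fin: "finite (In c)" and avg: "g c = (\<Sum>u\<in>In c. g u) / card (In c)"
  shows "between_nbrs In g c \<or> (\<forall>u \<in> In c. g u = g c)"
proof (cases "In c = {}")
  case False
  then have "real (card (In c)) > 0" using fin by (simp add: card_gt_0_iff)
  then have eq: "(\<Sum>u\<in>In c. g u) = (\<Sum>u\<in>In c. g c)"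
    using avg by (simp add: field_simps)
  have all_eq: "\<forall>u \<in> In c. g u = g c" if "\<forall>u \<in> In c. f u \<ge> 0" and f: "f = (\<lambda>u. g u - g c) \<or> f = (\<lambda>u. g c - g u)"
    for f
  proof -
    have "(\<Sum>u\<in>In c. f u) = 0"
      using f eq by (auto simp: sum_subtractf)
    then have "\<forall>u \<in> In c. f u = 0"
      using that(1) fin by (simp add: sum_nonneg_eq_0_iff)
    then show ?thesis using f by auto
  qed
  show ?thesis
    using all_eq[of "\<lambda>u. g u - g c"] all_eq[of "\<lambda>u. g c - g u"]
    unfolding between_nbrs_def by (meson diff_ge_0_iff_ge not_le)
qed simp

text \<open>The harmonic extension of the boundary values is the limit of repeated averaging.\<close>

lemma harmonic_extension:
  fixes In :: "'a \<Rightarrow> 'a set"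
  assumes fin: "\<And>c. c \<in> U \<Longrightarrow> finite (In c)" and x0: "x0 \<notin> U"
  obtains g :: "'a \<Rightarrow> real" where "g x0 = 1" "\<And>c. c \<notin> U \<Longrightarrow> c \<noteq> x0 \<Longrightarrow> g c = 0"
    "\<And>c. 0 \<le> g c" "\<And>c. g c \<le> 1" "\<And>c. c \<in> U \<Longrightarrow> g c = (\<Sum>u\<in>In c. g u) / card (In c)"
proof -
  define b :: "'a \<Rightarrow> real" where "b = (\<lambda>c. if c = x0 then 1 else 0)"
  define step :: "('a \<Rightarrow> real) \<Rightarrow> 'a \<Rightarrow> real" where
    "step = (\<lambda>g c. if c \<in> U then (\<Sum>u\<in>In c. g u) / card (In c) else b c)"
  define G where "G = (\<lambda>n. (step ^^ n) b)"
  have GS: "G (Suc n) = step (G n)" for n by (simp add: G_def)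
  have step_mono: "step f c \<le> step g c" if "\<And>c. f c \<le> g c" for f g c
    using that by (auto simp: step_def intro!: divide_right_mono sum_mono)
  have G0: "0 \<le> G n c" for n c
    by (induction n arbitrary: c) (auto simp: GS step_def b_def G_def intro!: divide_nonneg_nonneg sum_nonneg)
  have G1: "G n c \<le> 1" for n c
  proof (induction n arbitrary: c)
    case (Suc n)
    have "(\<Sum>u\<in>In c. G n u) / card (In c) \<le> 1"
    proof (cases "card (In c) = 0")
      case False
      have "(\<Sum>u\<in>In c. G n u) \<le> (\<Sum>u\<in>In c. 1)" by (intro sum_mono Suc)
      then show ?thesis using False by (simp add: field_simps)
    qed simp
    then show ?case by (simp add: GS step_def b_def)
  qed (simp add: G_def b_def)
  \<comment> \<open>The start \<open>b\<close> vanishes on \<open>U\<close>, since \<open>x0\<close>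
    lies outside \<open>U\<close>, so the first step only raises values; monotonicity of
    \<open>step\<close> carries this on.\<close>
  have "G n c \<le> G (Suc n) c" for n c
  proof (induction n arbitrary: c)
    case 0
    show ?case using x0 G0[of 1 c] by (auto simp: G_def step_def b_def)
  next
    case (Suc n)
    then show ?case unfolding GS[of "Suc n"] GS[of n] by (intro step_mono) (simp add: GS)
  qed
  then have inc: "incseq (\<lambda>n. G n c)" for c by (simp add: incseq_SucI)
  have "\<exists>L. (\<lambda>n. G n c) \<longlonglongrightarrow> L" for c
    using incseq_convergent[OF inc, of c 1] G1 by metis
  then obtain g where lim: "\<And>c. (\<lambda>n. G n c) \<longlonglongrightarrow> g c" by metis
  have lim_step: "(\<lambda>n. step (G n) c) \<longlonglongrightarrow> step g c" for c
    unfolding step_def using lim by (auto intro!: tendsto_divide_zero tendsto_intros simp: divide_inverse)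
  have "step g c = g c" for c
    using LIMSEQ_unique[OF lim_step[of c, folded GS] LIMSEQ_Suc[OF lim[of c]]] .
  then have g: "g c = step g c" for c by simp
  show thesis
  proof (rule that[of g])
    show "g x0 = 1" using x0 by (subst g) (simp add: step_def b_def)
    show "g c = 0" if "c \<notin> U" "c \<noteq> x0" for c using that by (subst g) (simp add: step_def b_def)
    show "0 \<le> g c" for c using LIMSEQ_le_const[OF lim[of c]] G0 by blast
    show "g c \<le> 1" for c using LIMSEQ_le_const2[OF lim[of c]] G1 by blast
    show "g c = (\<Sum>u\<in>In c. g u) / card (In c)" if "c \<in> U" for c
      using that by (subst g) (simp add: step_def)
  qed
qed

lemma finite_gap:
  fixes A :: "real set"
  assumes "finite A"
  obtains e where "e > 0" "\<And>a b. a \<in> A \<Longrightarrow> b \<in> A \<Longrightarrow> a < b \<Longrightarrow> a + e < b"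
proof -
  \<comment> \<open>The 1 keeps \<open>D\<close> nonempty, so that \<open>Min D\<close> is
    meaningful even if \<open>A\<close> has fewer than two values.\<close>
  define D where "D = insert 1 ((\<lambda>(a, b). b - a) ` {(a, b) \<in> A \<times> A. a < b})"
  have fin: "finite D" using assms unfolding D_def by (auto intro: finite_subset[of _ "A \<times> A"])
  have pos: "Min D > 0" using fin by (subst Min_gr_iff) (auto simp: D_def)
  show thesis
  proof (rule that[of "Min D / 2"])
    fix a b assume "a \<in> A" "b \<in> A" "a < b"
    then have "b - a \<in> D" by (force simp: D_def)
    then have "Min D \<le> b - a" using fin by simp
    then show "a + Min D / 2 < b" using pos by simp
  qed (use pos in simp)
qed

text \<open>
  Among the labellings in which every vertex outside \<open>S\<close> lies strictly between two in-neighbours or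
  is tied with all of them, one with the most values is injective: a class of tied vertices could be
  split by a harmonic function that separates two of its boundary vertices.
\<close>

lemma low_high_labelling:
  fixes In :: "'a \<Rightarrow> 'a set"
  assumes fin: "finite W" and In: "\<And>c. c \<in> W \<Longrightarrow> In c \<subseteq> W"
    and bd: "\<And>K. K \<subseteq> W \<Longrightarrow> min 2 (card K) \<le> card {c \<in> K. c \<in> S \<or> \<not> In c \<subseteq> K}"
  obtains h :: "'a \<Rightarrow> real" where "inj_on h W" "\<And>c. c \<in> W - S \<Longrightarrow> between_nbrs In h c"
proof -
  define weak :: "('a \<Rightarrow> real) \<Rightarrow> bool" where
    "weak = (\<lambda>h. \<forall>c \<in> W - S. between_nbrs In h c \<or> (\<forall>u \<in> In c. h u = h c))"
  have "weak (\<lambda>_. 0)" by (simp add: weak_def)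
  moreover have "\<forall>h :: 'a \<Rightarrow> real. card (h ` W) \<le> card W" using fin card_image_le by blast
  ultimately obtain h where h: "weak h" and max: "\<And>h'. weak h' \<Longrightarrow> card (h' ` W) \<le> card (h ` W)"
    using ex_has_greatest_nat[of weak "\<lambda>_. 0" "\<lambda>h. card (h ` W)" "Suc (card W)"]
    by (auto simp: less_Suc_eq_le)
  have inj: "inj_on h W"
  proof (rule ccontr)
    assume "\<not> inj_on h W"
    then obtain y z where yz: "y \<in> W" "z \<in> W" "h y = h z" "y \<noteq> z" by (auto simp: inj_on_def)
    define K where "K = {c \<in> W. h c = h y}"
    \<comment> \<open>The vertices of the tied class whose in-neighbours are all tied with them; on
      these the correction has to be harmonic.\<close>
    define U where "U = {c \<in> K. c \<notin> S \<and> \<not> between_nbrs In h c}"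
    have KW: "K \<subseteq> W" by (auto simp: K_def)
    then have finK: "finite K" using fin finite_subset by blast
    have InU: "In c \<subseteq> K" if "c \<in> U" for c
      using that h In unfolding U_def K_def weak_def by fastforce
    define B where "B = {c \<in> K. c \<in> S \<or> \<not> In c \<subseteq> K}"
    have "{y, z} \<subseteq> K" using yz by (auto simp: K_def)
    then have "card {y, z} \<le> card K" using finK card_mono by blast
    then have "2 \<le> card B" using bd[OF KW] yz by (simp add: B_def)
    then obtain x0 x1 where "x0 \<in> B" "x1 \<in> B" and x01: "x0 \<noteq> x1"
      by (metis card_2_iff' obtain_subset_with_card_n subsetD)
    then have xU: "x0 \<in> K - U" "x1 \<in> K - U" using InU by (auto simp: B_def U_def)
    obtain g where g: "g x0 = 1" "\<And>c. c \<notin> U \<Longrightarrow> c \<noteq> x0 \<Longrightarrow> g c = 0" "\<And>c. 0 \<le> g c" "\<And>c. g c \<le> (1::real)"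
      "\<And>c. c \<in> U \<Longrightarrow> g c = (\<Sum>u\<in>In c. g u) / card (In c)"
      using harmonic_extension[of U In x0] xU InU finK finite_subset by (metis DiffD2)
    obtain e where e: "e > 0" "\<And>a b. a \<in> h ` W \<Longrightarrow> b \<in> h ` W \<Longrightarrow> a < b \<Longrightarrow> a + e < b"
      using finite_gap[of "h ` W"] fin by blast
    \<comment> \<open>A shift by at most \<open>e\<close> stays below every gap between values of
      \<open>h\<close>, so no strict inequality is lost.\<close>
    define h' where "h' = (\<lambda>c. if c \<in> K then h c + e * g c else h c)"
    have h'_ge: "h c \<le> h' c" and h'_le: "h' c \<le> h c + e" for c
      using e(1) g(3,4)[of c] mult_left_le[of "g c" e] by (auto simp: h'_def)
    have mono: "h' x < h' y" if "x \<in> W" "y \<in> W" "h x < h y" for x y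
      using e(2)[of "h x" "h y"] that h'_le[of x] h'_ge[of y] by force
    have "weak h'"
      unfolding weak_def
    proof
      fix c assume c: "c \<in> W - S"
      show "between_nbrs In h' c \<or> (\<forall>u \<in> In c. h' u = h' c)"
      proof (cases "between_nbrs In h c")
        case True
        then show ?thesis using mono c In unfolding between_nbrs_def by (meson DiffD1 subsetD)
      next
        case False
        then have tied: "\<forall>u \<in> In c. h u = h c" using h c by (auto simp: weak_def)
        show ?thesis
        proof (cases "c \<in> K")
          case True
          then have cU: "c \<in> U" using False c by (simp add: U_def)
          have "finite (In c)" using InU[OF cU] finK finite_subset by blast
          then have "between_nbrs In g c \<or> (\<forall>u \<in> In c. g u = g c)"
            using between_nbrs_if_average[of In c g] g(5)[OF cU] by blast
          moreover have "h' u = h y + e * g u" if "u \<in> In c \<or> u = c" for u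
            using that InU[OF cU] True by (auto simp: h'_def K_def)
          ultimately show ?thesis using e(1) unfolding between_nbrs_def by (auto simp: Bex_def)
        next
          case False
          then have "u \<notin> K" if "u \<in> In c" for u using tied that c by (auto simp: K_def)
          then show ?thesis using False tied by (simp add: h'_def)
        qed
      qed
    qed
    \<comment> \<open>\<open>q\<close> recovers \<open>h\<close> from \<open>h'\<close>. Maximality
      makes it injective on the values of \<open>h'\<close>, yet \<open>h'\<close> separates
      \<open>x0\<close> from \<open>x1\<close>, where \<open>g\<close> is 1 and 0, and
      \<open>h\<close> does not.\<close>
    define q where "q = (\<lambda>v. h (inv_into W h' v))"
    have q: "q (h' x) = h x" if "x \<in> W" for x
    proof -
      define x' where "x' = inv_into W h' (h' x)"
      have "x' \<in> W" "h' x' = h' x" unfolding x'_def using that by (auto simp: inv_into_into f_inv_into_f)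
      then have "h x' = h x" using mono that by (metis less_irrefl linorder_neqE)
      then show ?thesis by (simp add: q_def x'_def)
    qed
    then have im: "q ` h' ` W = h ` W" by force
    have "card (q ` h' ` W) = card (h' ` W)"
      using max[OF \<open>weak h'\<close>] card_image_le[of "h' ` W" q] fin im by simp
    then have "inj_on q (h' ` W)" using fin by (simp add: eq_card_imp_inj_on)
    moreover have "q (h' x0) = q (h' x1)" using q xU by (auto simp: K_def)
    ultimately have "h' x0 = h' x1" using xU KW unfolding inj_on_def by blast
    then show False using xU x01 g(1) g(2)[of x1] e(1) by (auto simp: h'_def K_def)
  qed
  show thesis
  proof (rule that[OF inj])
    fix c assume c: "c \<in> W - S"
    \<comment> \<open>The boundary hypothesis for the singleton of \<open>c\<close> supplies an
      in-neighbour other than \<open>c\<close>, which injectivity does not allow to be tied with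
      \<open>c\<close>.\<close>
    then have "In c \<noteq> {} \<and> \<not> In c \<subseteq> {c}"
      using bd[of "{c}"] by (auto simp: card_gt_0_iff Suc_le_eq split: if_splits)
    then obtain u where "u \<in> In c" "u \<noteq> c" by blast
    then have "h u \<noteq> h c" using inj In[of c] c by (auto simp: inj_on_def)
    then show "between_nbrs In h c" using h c \<open>u \<in> In c\<close> by (auto simp: weak_def)
  qed
qed

section \<open>Lexicographic keys of rooted trees\<close>

text \<open>Negation reverses the comparison at the first entry where two lists differ, so both
  inequalities leave only the case that \<open>xs\<close> runs out first.\<close>

lemma prefix_iff_le_map_uminus:
  fixes xs ys :: "real list"
  shows "prefix xs ys \<longleftrightarrow> xs \<le> ys \<and> map uminus xs \<le> map uminus ys"
proof (induction xs arbitrary: ys)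
  case Nil show ?case by simp
next
  case (Cons x xs)
  show ?case
  proof (cases ys)
    case Nil then show ?thesis by simp
  next
    case (Cons y zs)
    have "prefix (x # xs) (y # zs) \<longleftrightarrow> x = y \<and> xs \<le> zs \<and> map uminus xs \<le> map uminus zs"
      using Cons.IH[of zs] by simp
    then show ?thesis unfolding Cons by force
  qed
qed

lemma less_list_append_left: "xs < ys \<Longrightarrow> zs @ xs < zs @ (ys :: 'a :: order list)"
  by (induction zs) auto

text \<open>Parents come first, so the reflexive transitive closure leads from ancestors to
  descendants.\<close>

definition parent_rel :: "'a set \<Rightarrow> ('a \<Rightarrow> 'a) \<Rightarrow> ('a \<times> 'a) set" where
  "parent_rel W f = {(f v, v) | v. v \<in> W}"

lemma parent_rel_iff [simp]: "(u, v) \<in> parent_rel W f \<longleftrightarrow> v \<in> W \<and> u = f v"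
  by (auto simp: parent_rel_def)

lemma finite_parent_rel: "finite W \<Longrightarrow> finite (parent_rel W f)"
  by (simp add: parent_rel_def)

lemma acyclic_parent_rel:
  fixes key :: "'a \<Rightarrow> 'b :: order"
  assumes "\<And>v. v \<in> W \<Longrightarrow> key (f v) < key v"
  shows "acyclic (parent_rel W f)"
proof -
  have "key u < key v" if "(u, v) \<in> (parent_rel W f)\<^sup>+" for u v
    using that by induction (use assms in \<open>auto dest: order.strict_trans\<close>)
  then show ?thesis by (meson acyclic_def order_less_irrefl)
qed

lemma parent_rel_rtrancl_less:
  fixes key :: "'a \<Rightarrow> 'b :: order"
  assumes "\<And>v. v \<in> W \<Longrightarrow> key (f v) < key v" and "(u, v) \<in> (parent_rel W f)\<^sup>*"
  shows "key u \<le> key v"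
  using assms(2) by induction (use assms(1) in \<open>auto dest: order.strict_trans1 less_imp_le\<close>)

lemma parent_rel_rtranclD:
  assumes "(u, v) \<in> (parent_rel W f)\<^sup>*" "u \<noteq> v"
  shows "v \<in> W \<and> (u, f v) \<in> (parent_rel W f)\<^sup>*"
  using assms by (metis parent_rel_iff rtranclE)

lemma parent_rel_rtrancl_child:
  assumes "(u, v) \<in> (parent_rel W f)\<^sup>*" "u \<noteq> v"
  obtains w where "w \<in> W" "f w = u" "(w, v) \<in> (parent_rel W f)\<^sup>*"
  using assms by (metis parent_rel_iff converse_rtranclE)

locale rooted_tree =
  fixes W :: "'a set" and r :: 'a and f :: "'a \<Rightarrow> 'a"
  assumes fin: "finite W" and r: "r \<notin> W" and f: "v \<in> W \<Longrightarrow> f v \<in> insert r W"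
    and acyc: "acyclic (parent_rel W f)"
begin

lemma wf_parent: "wf (parent_rel W f)"
  using finite_acyclic_wf[OF finite_parent_rel[OF fin] acyc] .

text \<open>The labels on the path from the root. If \<open>h\<close> separates siblings, the
  lexicographic order of the keys is the depth-first preorder with children sorted by
  \<open>h\<close>.\<close>

definition key :: "('a \<Rightarrow> 'b) \<Rightarrow> 'a \<Rightarrow> 'b list" where
  "key h = wfrec (parent_rel W f) (\<lambda>k v. if v \<in> W then k (f v) @ [h v] else [])"

lemma key_rec: "key h v = (if v \<in> W then key h (f v) @ [h v] else [])"
  by (simp add: key_def wfrec[OF wf_parent, of _ v] cut_apply)

lemma key_root [simp]: "key h r = []"
  using r by (simp add: key_rec)

lemma key_step: "v \<in> W \<Longrightarrow> key h v = key h (f v) @ [h v]"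
  by (subst key_rec) simp

lemma key_induct [consumes 1, case_names root child]:
  assumes "v \<in> insert r W" "P r" "\<And>v. v \<in> W \<Longrightarrow> P (f v) \<Longrightarrow> P v"
  shows "P v"
  using assms(1)
proof (induction v rule: wf_induct_rule[OF wf_parent])
  case (1 v)
  then show ?case using assms(2,3) f[of v] by auto
qed

lemma key_map: "v \<in> insert r W \<Longrightarrow> key (\<lambda>v. g (h v)) v = map g (key h v)"
  by (induction v rule: key_induct) (simp_all add: key_step)

lemma root_anc: "v \<in> insert r W \<Longrightarrow> (r, v) \<in> (parent_rel W f)\<^sup>*"
  by (induction v rule: key_induct) (auto intro: rtrancl_into_rtrancl)

context
  fixes h :: "'a \<Rightarrow> 'b"
  assumes sib: "\<And>u v. u \<in> W \<Longrightarrow> v \<in> W \<Longrightarrow> f u = f v \<Longrightarrow> h u = h v \<Longrightarrow> u = v"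
begin

lemma key_inj:
  assumes "u \<in> insert r W" "v \<in> insert r W" "key h u = key h v"
  shows "u = v"
  using assms(2,1,3)
proof (induction v arbitrary: u rule: key_induct)
  case root
  show ?case
  proof (cases "u \<in> W")
    case True
    then show ?thesis using root(2) key_step[of u h] by simp
  qed (use root(1) in simp)
next
  case (child v)
  have ne: "key h v \<noteq> []" using key_step[OF child(1), of h] by simp
  then have u: "u \<in> W" using child(3,4) by auto
  have "key h (f u) @ [h u] = key h (f v) @ [h v]"
    using child(4) unfolding key_step[OF u] key_step[OF child(1)] .
  then have eq: "key h (f u) = key h (f v)" "h u = h v" by simp_all
  show ?case using sib[OF u child(1) child(2)[OF f[OF u] eq(1)] eq(2)] .
qed

text \<open>Together with \<open>prefix_iff_le_map_uminus\<close> this turns ancestry into two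
  inequalities, for the dominator tree as well as for an arbitrary tree in
  \<open>card_transversal_le\<close>.\<close>

lemma prefix_key_iff:
  assumes u: "u \<in> insert r W" and v: "v \<in> insert r W"
  shows "prefix (key h u) (key h v) \<longleftrightarrow> (u, v) \<in> (parent_rel W f)\<^sup>*"
proof
  show "(u, v) \<in> (parent_rel W f)\<^sup>*" if "prefix (key h u) (key h v)"
    using v that
  proof (induction v rule: key_induct)
    case root
    then have "u = r" using key_inj[OF u, of r] by simp
    then show ?case by simp
  next
    case (child v)
    from child(3) have "key h u = key h v \<or> prefix (key h u) (key h (f v))"
      by (simp only: key_step[OF child(1)] prefix_snoc)
    then show ?case
    proof
      assume "key h u = key h v"
      then have "u = v" using key_inj[OF u, of v] child(1) by simp
      then show ?thesis by simp
    next
      assume "prefix (key h u) (key h (f v))"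
      then show ?thesis using child(1,2) by (simp add: rtrancl.rtrancl_into_rtrancl)
    qed
  qed
next
  assume "(u, v) \<in> (parent_rel W f)\<^sup>*"
  then show "prefix (key h u) (key h v)"
  proof induction
    case (step y z)
    then have "prefix (key h y) (key h z)" using key_step[of z h] by simp
    with step.IH show ?case by (rule prefix_order.trans)
  qed simp
qed

end

end

section \<open>Dense families of branch sets\<close>

definition conn :: "('a \<times> 'a) set \<Rightarrow> 'a set \<Rightarrow> bool" where
  "conn E B \<longleftrightarrow> B \<noteq> {} \<and> (\<forall>x \<in> B. \<forall>y \<in> B. (x, y) \<in> (E \<inter> B \<times> B)\<^sup>*)"

definition adj :: "('a \<times> 'a) set \<Rightarrow> 'a set \<Rightarrow> 'a set \<Rightarrow> bool" where
  "adj E B B' \<longleftrightarrow> B \<noteq> B' \<and> (\<exists>x \<in> B. \<exists>y \<in> B'. (x, y) \<in> E)"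

definition branch_family :: "('a \<times> 'a) set \<Rightarrow> 'a set set \<Rightarrow> bool" where
  "branch_family E F \<longleftrightarrow> finite F \<and> (\<forall>B \<in> F. conn E B) \<and> pairwise disjnt F"

text \<open>Ordered pairs: for symmetric \<open>E\<close> each adjacency counts twice, so the number
  of pairs per member is the average degree.\<close>

definition adj_pairs :: "('a \<times> 'a) set \<Rightarrow> 'a set set \<Rightarrow> ('a set \<times> 'a set) set" where
  "adj_pairs E F = {(B, B'). B \<in> F \<and> B' \<in> F \<and> adj E B B'}"

lemma adj_sym: "sym E \<Longrightarrow> adj E B B' \<Longrightarrow> adj E B' B"
  unfolding adj_def by (metis symD)

lemma conn_Un:
  assumes "sym E" "conn E B" "conn E B'" "adj E B B'"
  shows "conn E (B \<union> B')"
proof -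
  let ?R = "E \<inter> (B \<union> B') \<times> (B \<union> B')"
  have symR: "sym (?R\<^sup>*)" by (intro sym_rtrancl) (use assms(1) in \<open>auto simp: sym_def\<close>)
  have mono: "(E \<inter> B \<times> B)\<^sup>* \<subseteq> ?R\<^sup>*" "(E \<inter> B' \<times> B')\<^sup>* \<subseteq> ?R\<^sup>*" by (intro rtrancl_mono; blast)+
  obtain a b where ab: "a \<in> B" "b \<in> B'" "(a, b) \<in> E" using assms(4) by (auto simp: adj_def)
  then have "(a, b) \<in> ?R\<^sup>*" by blast
  then have "(x, a) \<in> ?R\<^sup>*" if "x \<in> B \<union> B'" for x
  proof (cases "x \<in> B")
    case True
    then show ?thesis using assms(2) ab(1) mono(1) by (auto simp: conn_def)
  next
    case False
    then have "(x, b) \<in> ?R\<^sup>*" using that assms(3) ab(2) mono(2) by (auto simp: conn_def)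
    moreover have "(b, a) \<in> ?R\<^sup>*" using \<open>(a, b) \<in> ?R\<^sup>*\<close> symR by (rule symD[rotated])
    ultimately show ?thesis by (rule rtrancl_trans)
  qed
  then have "(x, y) \<in> ?R\<^sup>*" if "x \<in> B \<union> B'" "y \<in> B \<union> B'" for x y
    using that symD[OF symR, of y a] rtrancl_trans[of x a ?R y] by blast
  then show ?thesis using ab(1) unfolding conn_def by blast
qed

lemma branch_family_subset: "branch_family E F \<Longrightarrow> F' \<subseteq> F \<Longrightarrow> branch_family E F'"
  unfolding branch_family_def by (meson finite_subset pairwise_subset subset_eq)

lemma branch_family_merge:
  assumes "sym E" "branch_family E F" "B \<in> F" "B' \<in> F" "adj E B B'"
  shows "branch_family E (insert (B \<union> B') (F - {B, B'}))"
  using assms conn_Un[of E B B'] unfolding branch_family_def pairwise_insert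
  by (auto simp: pairwise_def disjnt_def)

text \<open>The last clause makes the model extensible: a set adjacent to and disjoint from all
  members of \<open>F\<close> is adjacent to and disjoint from every member of
  \<open>C\<close>.\<close>

definition complete_model :: "('a \<times> 'a) set \<Rightarrow> 'a set set \<Rightarrow> nat \<Rightarrow> 'a set set \<Rightarrow> bool" where
  "complete_model E F h C \<longleftrightarrow> branch_family E C \<and> card C = h \<and> pairwise (adj E) C \<and>
     (\<forall>X \<in> C. X \<subseteq> \<Union>F \<and> (\<exists>B \<in> F. B \<subseteq> X))"

lemma adj_mono: "adj E B B' \<Longrightarrow> B \<subseteq> X \<Longrightarrow> B' \<subseteq> Y \<Longrightarrow> X \<noteq> Y \<Longrightarrow> adj E X Y"
  unfolding adj_def by blast

text \<open>
  Mader's induction. Merging two adjacent members with fewer than \<open>2 ^ h\<close> common neighbours keeps the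
  density; if no such pair exists, the neighbourhood of any member is dense enough for \<open>h\<close>.
\<close>

lemma complete_model_if_dense:
  assumes symE: "sym E" and "branch_family E F" "F \<noteq> {}" "2 ^ h * card F \<le> card (adj_pairs E F)"
  shows "\<exists>C. complete_model E F h C"
  using assms(2-)
proof (induction h arbitrary: F)
  case 0
  show ?case by (intro exI[of _ "{}"]) (simp add: complete_model_def branch_family_def)
next
  case (Suc h)
  note outer = Suc.IH
  show ?case using Suc.prems
  proof (induction "card F" arbitrary: F rule: less_induct)
    case less
    note F = less.prems(1) and dense = less.prems(3)
    have finF: "finite F" using F by (simp add: branch_family_def)
    define nb where "nb = (\<lambda>B. {X \<in> F. adj E B X})"
    have finP: "finite (adj_pairs E F)"
      by (rule finite_subset[of _ "F \<times> F"]) (use finF in \<open>auto simp: adj_pairs_def\<close>)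
    have "card F > 0" using finF less.prems(2) by (simp add: card_gt_0_iff)
    then have "adj_pairs E F \<noteq> {}" using dense by (auto dest: leD)
    then obtain B0 B1 where B01: "B0 \<in> F" "B1 \<in> F" "adj E B0 B1" by (auto simp: adj_pairs_def)
    show ?case
    proof (cases "\<exists>B \<in> F. \<exists>B' \<in> F. adj E B B' \<and> card (nb B \<inter> nb B') < 2 ^ h")
      case True
      then obtain B B' where BB: "B \<in> F" "B' \<in> F" "adj E B B'" and few: "card (nb B \<inter> nb B') < 2 ^ h"
        by blast
      define M where "M = B \<union> B'"
      define F' where "F' = insert M (F - {B, B'})"
      have F': "branch_family E F'" unfolding F'_def M_def by (rule branch_family_merge[OF symE F BB])
      have BneB: "B \<noteq> B'" using BB by (simp add: adj_def)
      have ne: "X \<noteq> {}" "disjnt X Y" if "X \<in> F" "Y \<in> F" "X \<noteq> Y" for X Y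
        using F that by (auto simp: branch_family_def conn_def pairwise_def)
      have MF: "M \<noteq> X" if "X \<in> F" for X
        using ne[OF BB(1) BB(2) BneB] ne[OF BB(2) BB(1)] ne(2)[OF BB(1) that] ne(2)[OF BB(2) that] BneB
        unfolding M_def disjnt_def by blast
      have cF': "Suc (card F') = card F"
      proof -
        have "card F' = Suc (card (F - {B, B'}))" unfolding F'_def using finF MF by (subst card_insert_disjoint) auto
        also have "card (F - {B, B'}) = card F - 2" using BB BneB finF by (simp add: card_Diff_subset)
        finally show ?thesis using card_mono[OF finF, of "{B, B'}"] BB BneB by simp
      qed
      define c where "c = (\<lambda>X. if X = B' \<or> X = B then M else X)"
      \<comment> \<open>The pairs lost in the merge: the merged pair in both orders, and one of the
        two pairs that coincide for each common neighbour, again in both orders. These are at most 2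
        + 2 * (2 ^ h - 1), which is what losing one member allows.\<close>
      define L where "L = {(B, B'), (B', B)} \<union> (\<lambda>X. (B', X)) ` (nb B \<inter> nb B') \<union> (\<lambda>X. (X, B')) ` (nb B \<inter> nb B')"
      have finN: "finite (nb B \<inter> nb B')" using finF by (simp add: nb_def)
      have cL: "card L \<le> 2 ^ Suc h"
      proof -
        let ?N = "nb B \<inter> nb B'"
        have "card L \<le> card ({(B, B'), (B', B)} \<union> (\<lambda>X. (B', X)) ` ?N) + card ((\<lambda>X. (X, B')) ` ?N)"
          unfolding L_def by (rule card_Un_le)
        also have "\<dots> \<le> card {(B, B'), (B', B)} + card ((\<lambda>X. (B', X)) ` ?N) + card ((\<lambda>X. (X, B')) ` ?N)"
          by (intro add_right_mono card_Un_le)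
        also have "card {(B, B'), (B', B)} = 2" using BneB by simp
        also have "2 + card ((\<lambda>X. (B', X)) ` ?N) + card ((\<lambda>X. (X, B')) ` ?N) \<le> 2 + card ?N + card ?N"
          using card_image_le[OF finN, of "\<lambda>X. (B', X)"] card_image_le[OF finN, of "\<lambda>X. (X, B')"] by linarith
        finally show ?thesis using few by simp
      qed
      have "map_prod c c ` (adj_pairs E F - L) \<subseteq> adj_pairs E F'"
      proof (rule image_subsetI)
        fix p assume "p \<in> adj_pairs E F - L"
        then obtain X Y where p: "p = (X, Y)" and XY: "(X, Y) \<in> adj_pairs E F" "(X, Y) \<notin> L" by (cases p) auto
        have sub: "X \<subseteq> c X" "Y \<subseteq> c Y" by (auto simp: c_def M_def)
        have XYF: "X \<in> F" "Y \<in> F" and ad: "adj E X Y" using XY(1) by (auto simp: adj_pairs_def)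
        have "\<not> (X \<in> {B, B'} \<and> Y \<in> {B, B'})" using XY(2) ad by (auto simp: L_def adj_def)
        moreover have "X \<noteq> Y" using ad by (simp add: adj_def)
        ultimately have "c X \<noteq> c Y" using MF[OF XYF(1)] MF[OF XYF(2)] unfolding c_def by auto
        then have "adj E (c X) (c Y)" using adj_mono[OF ad sub] by blast
        then show "map_prod c c p \<in> adj_pairs E F'"
          using XYF unfolding p by (auto simp: adj_pairs_def c_def F'_def)
      qed
      moreover have "inj_on (map_prod c c) (adj_pairs E F - L)"
      proof (rule inj_onI)
        fix p p' assume pp: "p \<in> adj_pairs E F - L" "p' \<in> adj_pairs E F - L" "map_prod c c p = map_prod c c p'"
        obtain X Y X' Y' where p: "p = (X, Y)" "p' = (X', Y')" by (cases p, cases p') blast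
        have a: "(X, Y) \<in> adj_pairs E F" "(X, Y) \<notin> L" "(X', Y') \<in> adj_pairs E F" "(X', Y') \<notin> L"
          using pp p by auto
        from pp p have eq: "c X = c X'" "c Y = c Y'" by auto
        have inF: "X \<in> F" "Y \<in> F" "X' \<in> F" "Y' \<in> F" and ad: "adj E X Y" "adj E X' Y'"
          using a by (auto simp: adj_pairs_def)
        have cc: "Z = Z' \<or> Z \<in> {B, B'} \<and> Z' \<in> {B, B'}" if "c Z = c Z'" "Z \<in> F" "Z' \<in> F" for Z Z'
          using that MF by (auto simp: c_def split: if_splits)
        have notboth: "\<not> (X \<in> {B, B'} \<and> Y \<in> {B, B'})" "\<not> (X' \<in> {B, B'} \<and> Y' \<in> {B, B'})"
          using a(2,4) ad by (auto simp: L_def adj_def)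
        have "X = X' \<and> Y = Y'"
        proof (rule ccontr)
          assume neq: "\<not> (X = X' \<and> Y = Y')"
          consider "X \<noteq> X'" | "Y \<noteq> Y'" using neq by blast
          then show False
          proof cases
            case 1
            then have m: "X \<in> {B, B'}" "X' \<in> {B, B'}" using cc eq inF by blast+
            then have "Y = Y'" using cc[OF eq(2)] inF notboth by blast
            then have "Y \<in> nb B \<inter> nb B'" using m 1 ad inF by (auto simp: nb_def)
            then show False using m 1 a(2,4) \<open>Y = Y'\<close> by (auto simp: L_def)
          next
            case 2
            then have m: "Y \<in> {B, B'}" "Y' \<in> {B, B'}" using cc eq inF by blast+
            then have "X = X'" using cc[OF eq(1)] inF notboth by blast
            then have "X \<in> nb B \<inter> nb B'" using m 2 ad inF symE by (auto simp: nb_def dest: adj_sym)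
            then show False using m 2 a(2,4) \<open>X = X'\<close> by (auto simp: L_def)
          qed
        qed
        then show "p = p'" using p by simp
      qed
      moreover have "finite (adj_pairs E F')"
        by (rule finite_subset[of _ "F' \<times> F'"]) (use finF in \<open>auto simp: adj_pairs_def F'_def\<close>)
      ultimately have "card (adj_pairs E F - L) \<le> card (adj_pairs E F')"
        by (meson card_inj_on_le)
      moreover have "card (adj_pairs E F) - card L \<le> card (adj_pairs E F - L)"
        using finN by (intro diff_card_le_card_Diff) (simp add: L_def)
      ultimately have "2 ^ Suc h * card F' \<le> card (adj_pairs E F')"
        using dense cL unfolding cF'[symmetric] mult_Suc_right by linarith
      moreover have "F' \<noteq> {}" "card F' < card F" using cF' by (auto simp: F'_def)
      ultimately obtain C where "complete_model E F' (Suc h) C" using less.hyps F' by blast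
      moreover have "\<Union>F' \<subseteq> \<Union>F" using BB by (auto simp: F'_def M_def)
      moreover have "\<exists>Z \<in> F. Z \<subseteq> X" if "X \<in> F'" for X using that BB by (auto simp: F'_def M_def)
      ultimately have "complete_model E F (Suc h) C"
        unfolding complete_model_def by (meson order_trans)
      then show ?thesis by blast
    next
      case False
      define N where "N = nb B0"
      have NF: "N \<subseteq> F" and N_ne: "N \<noteq> {}" using B01 by (auto simp: N_def nb_def)
      have finN: "finite N" using NF finF finite_subset by blast
      \<comment> \<open>A common neighbour of \<open>B0\<close> and \<open>X\<close> is a neighbour
        of \<open>X\<close> inside \<open>N\<close>, so \<open>N\<close> has density at least
        \<open>2 ^ h\<close>.\<close>
      have "card N * 2 ^ h \<le> (\<Sum>X\<in>N. card (nb B0 \<inter> nb X))"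
        using sum_mono[of N "\<lambda>_. 2 ^ h" "\<lambda>X. card (nb B0 \<inter> nb X)"] False B01(1)
        by (auto simp: N_def nb_def not_less)
      also have "\<dots> = card (SIGMA X:N. nb B0 \<inter> nb X)" using finN finF by (simp add: nb_def)
      also have "(SIGMA X:N. nb B0 \<inter> nb X) = adj_pairs E N" by (auto simp: adj_pairs_def N_def nb_def)
      finally obtain C where C: "complete_model E N h C"
        using outer[OF branch_family_subset[OF F NF] N_ne] by (auto simp: mult.commute)
      have disj: "disjnt B0 X" if "X \<in> N" for X
        using that F B01 by (auto simp: N_def nb_def adj_def branch_family_def pairwise_def)
      have B0: "conn E B0" "B0 \<noteq> {}" using F B01 by (auto simp: branch_family_def conn_def)
      have sep: "disjnt B0 X" if "X \<in> C" for X
      proof -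
        have "X \<subseteq> \<Union>N" using that C by (simp add: complete_model_def)
        then show ?thesis using disj unfolding disjnt_def by blast
      qed
      have B0C: "B0 \<notin> C" using sep[of B0] B0(2) unfolding disjnt_def by blast
      have adj0: "adj E B0 X" if "X \<in> C" for X
      proof -
        have "\<exists>Z \<in> N. Z \<subseteq> X" using that C by (simp add: complete_model_def)
        then obtain Z where "Z \<in> N" "Z \<subseteq> X" by blast
        moreover have "B0 \<noteq> X" using B0C that by blast
        ultimately show ?thesis using adj_mono[of E B0 Z B0 X] by (simp add: N_def nb_def)
      qed
      have Cfam: "finite C" "\<forall>X \<in> C. conn E X" "pairwise disjnt C" "card C = h" "pairwise (adj E) C"
        using C by (auto simp: complete_model_def branch_family_def)
      have "X \<subseteq> \<Union>F \<and> (\<exists>B \<in> F. B \<subseteq> X)" if X: "X \<in> insert B0 C" for X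
      proof (cases "X = B0")
        case False
        then have "X \<subseteq> \<Union>N" "\<exists>B \<in> N. B \<subseteq> X" using X C by (auto simp: complete_model_def)
        then show ?thesis using NF by (meson Union_mono order_trans subsetD)
      qed (use B01(1) in blast)
      moreover have "pairwise disjnt (insert B0 C)"
        using Cfam(3) sep by (auto simp: pairwise_insert disjnt_sym)
      moreover have "pairwise (adj E) (insert B0 C)"
        using Cfam(5) adj0 adj_sym[OF symE] by (auto simp: pairwise_insert)
      ultimately have "complete_model E F (Suc h) (insert B0 C)"
        using Cfam B0(1) B0C unfolding complete_model_def branch_family_def by simp
      then show ?thesis by blast
    qed
  qed
qed

section \<open>Digraphs whose outbranchings have few leaves\<close>

lemma card_ge_twice_image:
  assumes fin: "finite N" and two: "\<And>v. v \<in> N \<Longrightarrow> \<exists>v' \<in> N. v' \<noteq> v \<and> f v' = f v"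
  shows "2 * card (f ` N) \<le> card N"
proof -
  have "2 \<le> card {v \<in> N. f v = y}" if y: "y \<in> f ` N" for y
  proof -
    obtain v where v: "v \<in> N" "f v = y" using y by blast
    then obtain v' where "v' \<in> N" "v' \<noteq> v" "f v' = y" using two[OF v(1)] by auto
    note v this
    then have "card {v, v'} \<le> card {v \<in> N. f v = y}" using fin by (intro card_mono) auto
    then show ?thesis using \<open>v' \<noteq> v\<close> by simp
  qed
  then have "(\<Sum>y\<in>f ` N. 2) \<le> (\<Sum>y\<in>f ` N. card {v \<in> N. f v = y})" by (intro sum_mono) simp
  also have "\<dots> = (\<Sum>y\<in>f ` N. \<Sum>v\<in>{v \<in> N. f v = y}. 1)" by simp
  also have "\<dots> = (\<Sum>v\<in>N. 1)" using sum.image_gen[OF fin, of "\<lambda>_. 1 :: nat" f] by (rule sym)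
  also have "\<dots> = card N" by simp
  finally show ?thesis by simp
qed

text \<open>A vertex of \<open>Y\<close> has on average at most one preimage in \<open>Y\<close>, so
  some \<open>v\<close> has at most one. Choosing \<open>v\<close> and discarding it with its image
  and its preimage spends three vertices per choice.\<close>

lemma independent_subset_functional_graph:
  fixes f :: "'a \<Rightarrow> 'a"
  assumes "finite Y"
  shows "\<exists>I \<subseteq> Y. card Y \<le> 3 * card I \<and> (\<forall>v \<in> I. f v \<in> I \<longrightarrow> f v = v)"
  using assms
proof (induction "card Y" arbitrary: Y rule: less_induct)
  case less
  show ?case
  proof (cases "Y = {}")
    case False
    have "\<exists>v \<in> Y. card {u \<in> Y. f u = v} \<le> 1"
    proof (rule ccontr)
      assume "\<not> ?thesis"
      then have "(\<Sum>v\<in>Y. 2) \<le> (\<Sum>v\<in>Y. card {u \<in> Y. f u = v})" by (intro sum_mono) (auto simp: not_le)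
      also have "\<dots> = card (\<Union>v\<in>Y. {u \<in> Y. f u = v})" using less(2) by (subst card_UN_disjoint) auto
      also have "\<dots> \<le> card Y" using less(2) by (intro card_mono) auto
      finally show False using False less(2) by (simp add: card_gt_0_iff)
    qed
    then obtain v where v: "v \<in> Y" and one: "card {u \<in> Y. f u = v} \<le> 1" by blast
    have "\<forall>a \<in> {u \<in> Y. f u = v}. \<forall>b \<in> {u \<in> Y. f u = v}. a = b"
      using one less(2) card_le_Suc0_iff_eq[of "{u \<in> Y. f u = v}"] by simp
    then obtain u where u: "{u \<in> Y. f u = v} \<subseteq> {u}" by blast
    define R where "R = {v, f v, u}"
    have "card R \<le> 3" by (simp add: R_def card_insert_if)
    then have cY: "card Y \<le> card (Y - R) + 3" using diff_card_le_card_Diff[of R Y] by (simp add: R_def)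
    have "card (Y - R) < card Y" using v less(2) by (intro psubset_card_mono) (auto simp: R_def)
    then obtain I where I: "I \<subseteq> Y - R" "card (Y - R) \<le> 3 * card I" "\<forall>v \<in> I. f v \<in> I \<longrightarrow> f v = v"
      using less(1)[of "Y - R"] less(2) by auto
    have "finite I" "v \<notin> I" using I(1) less(2) finite_subset by (auto simp: R_def)
    then have "card Y \<le> 3 * card (insert v I)" using cY I(2) by simp
    moreover have "\<forall>w \<in> insert v I. f w \<in> insert v I \<longrightarrow> f w = w"
    proof clarify
      fix w assume w: "w \<in> insert v I" "f w \<in> insert v I"
      show "f w = w"
      proof (cases "w = v")
        case True
        then show ?thesis using w I(1) by (auto simp: R_def)
      next
        case False
        then have "w \<in> Y - R" using w(1) I(1) by blast
        then have "f w \<noteq> v" using u by (auto simp: R_def)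
        then show ?thesis using w False I(3) by simp
      qed
    qed
    moreover have "insert v I \<subseteq> Y" using I v by blast
    ultimately show ?thesis by blast
  qed simp
qed

locale few_leaves =
  fixes W :: "'a set" and r :: 'a and A :: "('a \<times> 'a) set" and l :: nat
  assumes finW: "finite W" and rW: "r \<notin> W"
    and AW: "(u, v) \<in> A \<Longrightarrow> u \<in> insert r W \<and> v \<in> W"
    and leaves_le: "(\<And>v. v \<in> W \<Longrightarrow> (f v, v) \<in> A) \<Longrightarrow> acyclic (parent_rel W f)
      \<Longrightarrow> card (insert r W - f ` W) \<le> l"
begin

definition siblings :: "('a \<Rightarrow> 'a) \<Rightarrow> 'a set" where
  "siblings f = {v \<in> W. \<exists>v' \<in> W. v' \<noteq> v \<and> f v' = f v}"

lemma siblings_inj: "v \<in> W \<Longrightarrow> v \<notin> siblings f \<Longrightarrow> v' \<in> W \<Longrightarrow> f v' = f v \<Longrightarrow> v' = v"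
  by (auto simp: siblings_def)

text \<open>Siblings share parents at least two by two, so they account for at most half as many
  parents as there are siblings; every parent saved is a leaf.\<close>

lemma card_siblings_le:
  assumes f: "\<And>v. v \<in> W \<Longrightarrow> (f v, v) \<in> A" and "acyclic (parent_rel W f)"
  shows "card (siblings f) \<le> 2 * l"
proof -
  let ?N = "siblings f"
  have N: "?N \<subseteq> W" "finite ?N" using finW by (auto simp: siblings_def)
  have "2 * card (f ` ?N) \<le> card ?N"
  proof (rule card_ge_twice_image[OF N(2)])
    fix v assume "v \<in> ?N"
    then obtain v' where v': "v \<in> W" "v' \<in> W" "v' \<noteq> v" "f v' = f v" by (auto simp: siblings_def)
    then have "v' \<in> ?N" unfolding siblings_def by force
    then show "\<exists>v' \<in> ?N. v' \<noteq> v \<and> f v' = f v" using v' by blast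
  qed
  moreover have "card (f ` W) \<le> card (f ` (W - ?N)) + card (f ` ?N)"
    using card_Un_le[of "f ` (W - ?N)" "f ` ?N"] N(1) by (metis Diff_partition Un_commute image_Un)
  moreover have "card (f ` (W - ?N)) \<le> card (W - ?N)" using finW by (simp add: card_image_le)
  moreover have "card (W - ?N) = card W - card ?N" "card ?N \<le> card W"
    using N finW by (auto simp: card_Diff_subset card_mono)
  moreover have "card (insert r W) \<le> card (insert r W - f ` W) + card (f ` W)"
    using diff_card_le_card_Diff[of "f ` W" "insert r W"] finW by simp
  moreover have "card (insert r W) = Suc (card W)" using finW rW by simp
  ultimately show ?thesis using leaves_le[OF assms] by linarith
qed

text \<open>
  Replacing the parent \<open>f v\<close> by \<open>g v\<close> on a subset of \<open>Y\<close> turns each former parent without other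
  children into a leaf, unless it becomes a new parent; a third of \<open>Y\<close> avoids that conflict.
\<close>

lemma card_flippable_le:
  fixes key :: "'a \<Rightarrow> 'b :: order"
  assumes f: "\<And>v. v \<in> W \<Longrightarrow> (f v, v) \<in> A \<and> key (f v) < key v"
    and Y: "Y \<subseteq> W" and g: "\<And>v. v \<in> Y \<Longrightarrow> (g v, v) \<in> A \<and> key (g v) < key v \<and> g v \<noteq> f v"
  shows "card Y \<le> 5 * l"
proof -
  have acyc: "acyclic (parent_rel W f)" using f acyclic_parent_rel[of W key f] by blast
  define Z where "Z = Y - siblings f"
  have finY: "finite Y" using Y finW finite_subset by blast
  have inj: "inj_on f Z" using Y siblings_inj unfolding inj_on_def Z_def by blast
  \<comment> \<open>\<open>inv_into Z f (g v)\<close> is the vertex of \<open>Z\<close> whose old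
    parent is \<open>g v\<close>, if there is one. Independence prevents that parent from being
    vacated in the same round; the fixed-point alternative contradicts
    \<open>g v \<noteq> f v\<close>.\<close>
  obtain I where I: "I \<subseteq> Z" "card Z \<le> 3 * card I"
    and indep: "\<And>v. v \<in> I \<Longrightarrow> inv_into Z f (g v) \<in> I \<Longrightarrow> inv_into Z f (g v) = v"
    using independent_subset_functional_graph[of Z "\<lambda>v. inv_into Z f (g v)"] finY by (auto simp: Z_def)
  define f' where "f' = (\<lambda>v. if v \<in> I then g v else f v)"
  have "I \<subseteq> Y" using I by (auto simp: Z_def)
  then have f': "(f' v, v) \<in> A \<and> key (f' v) < key v" if "v \<in> W" for v
    using f g that by (auto simp: f'_def)
  have "f ` I \<inter> f' ` W = {}"
  proof (rule ccontr)
    assume "f ` I \<inter> f' ` W \<noteq> {}"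
    then obtain v w where v: "v \<in> I" and w: "w \<in> W" and eq: "f v = f' w" by blast
    have vZ: "v \<in> Z" using v I by blast
    show False
    proof (cases "w \<in> I")
      case True
      then have gw: "g w = f v" using eq by (simp add: f'_def)
      then have "inv_into Z f (g w) = v" using inj vZ by simp
      then have "v = w" using indep[OF True] v by simp
      then show False using g[of w] gw True \<open>I \<subseteq> Y\<close> by auto
    next
      case False
      then have "f w = f v" using eq by (simp add: f'_def)
      then have "w = v" using siblings_inj[of v f w] vZ w Y by (auto simp: Z_def)
      then show False using False v by simp
    qed
  qed
  moreover have "f ` I \<subseteq> insert r W" using f AW I Y unfolding Z_def by blast
  ultimately have "card (f ` I) \<le> card (insert r W - f' ` W)" using finW by (intro card_mono) auto
  also have "\<dots> \<le> l" using f' acyclic_parent_rel[of W key f'] by (intro leaves_le) auto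
  finally have "card I \<le> l" using card_image[OF inj_on_subset[OF inj I(1)]] by simp
  \<comment> \<open>5 = 3 + 2: three times the vertices switched, and the siblings set
    aside.\<close>
  moreover have "card Y \<le> card Z + card (siblings f)"
    using diff_card_le_card_Diff[of "siblings f" Y] finW by (simp add: Z_def siblings_def)
  moreover have "card (siblings f) \<le> 2 * l" using card_siblings_le f acyc by blast
  ultimately show ?thesis using I(2) by linarith
qed

end

section \<open>Dominators and the low-high order\<close>

text \<open>The start must avoid \<open>Z\<close> as well, so nothing is reached if
  \<open>r \<in> Z\<close>; this makes \<open>r\<close> a dominator of every vertex.\<close>

inductive_set reach_avoiding :: "('a \<times> 'a) set \<Rightarrow> 'a \<Rightarrow> 'a set \<Rightarrow> 'a set" for A r Z where
  root: "r \<notin> Z \<Longrightarrow> r \<in> reach_avoiding A r Z"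
| step: "a \<in> reach_avoiding A r Z \<Longrightarrow> (a, b) \<in> A \<Longrightarrow> b \<notin> Z \<Longrightarrow> b \<in> reach_avoiding A r Z"

lemma reach_avoiding_notin: "v \<in> reach_avoiding A r Z \<Longrightarrow> v \<notin> Z"
  by (induction rule: reach_avoiding.induct) auto

lemma reach_avoiding_root: "v \<in> reach_avoiding A r Z \<Longrightarrow> r \<notin> Z"
  by (induction rule: reach_avoiding.induct) auto

lemma reach_avoiding_antimono: "v \<in> reach_avoiding A r Z' \<Longrightarrow> Z \<subseteq> Z' \<Longrightarrow> v \<in> reach_avoiding A r Z"
  by (induction rule: reach_avoiding.induct) (auto intro: reach_avoiding.intros)

locale flow_graph =
  fixes W :: "'a set" and r :: 'a and A :: "('a \<times> 'a) set"
  assumes finW: "finite W" and rW: "r \<notin> W"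
    and AW: "(u, v) \<in> A \<Longrightarrow> u \<in> insert r W \<and> v \<in> W"
    and irrefl: "(v, v) \<notin> A"
    and reach: "v \<in> insert r W \<Longrightarrow> v \<in> reach_avoiding A r {}"
begin

definition doms :: "'a \<Rightarrow> 'a \<Rightarrow> bool" where
  "doms x v \<longleftrightarrow> v \<notin> reach_avoiding A r {x}"

lemma doms_refl: "doms x x"
  using reach_avoiding_notin unfolding doms_def by fast

lemma doms_root: "doms r v"
  using reach_avoiding_root unfolding doms_def by fast

lemma doms_pred: "doms x b \<Longrightarrow> (a, b) \<in> A \<Longrightarrow> x \<noteq> b \<Longrightarrow> doms x a"
  using reach_avoiding.step[of a A r "{x}" b] by (auto simp: doms_def)

lemma doms_rootD: "doms x r \<Longrightarrow> x = r"
  using reach_avoiding.root[of r "{x}" A] by (auto simp: doms_def)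

lemma closed_superset:
  assumes "r \<in> U" "\<And>a b. a \<in> U \<Longrightarrow> (a, b) \<in> A \<Longrightarrow> b \<in> U"
  shows "insert r W \<subseteq> U"
proof
  fix v assume "v \<in> insert r W"
  then have "v \<in> reach_avoiding A r {}" by (rule reach)
  then show "v \<in> U" by induction (use assms in auto)
qed

lemma doms_in:
  assumes "doms x v" "v \<in> insert r W"
  shows "x \<in> insert r W"
proof (rule ccontr)
  assume x: "x \<notin> insert r W"
  have "insert r W \<subseteq> reach_avoiding A r {x}"
    by (rule closed_superset) (use x AW in \<open>auto intro: reach_avoiding.intros\<close>)
  then show False using assms by (auto simp: doms_def)
qed

lemma doms_trans:
  assumes "doms x y" "doms y v"
  shows "doms x v"
proof -
  \<comment> \<open>A path that avoids \<open>x\<close> cannot meet \<open>y\<close>, since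
    \<open>x\<close> dominates \<open>y\<close>.\<close>
  have "a \<in> reach_avoiding A r {y}" if "a \<in> reach_avoiding A r {x}" for a
    using that
  proof (induction rule: reach_avoiding.induct)
    case root
    then have "r \<in> reach_avoiding A r {x}" by (rule reach_avoiding.root)
    then have "r \<noteq> y" using assms(1) by (auto simp: doms_def)
    then show ?case by (simp add: reach_avoiding.root)
  next
    case (step a b)
    then have "b \<in> reach_avoiding A r {x}" by (meson reach_avoiding.step)
    then have "b \<noteq> y" using assms(1) by (auto simp: doms_def)
    then show ?case using reach_avoiding.step[OF step.IH step.hyps(2)] by simp
  qed
  then show ?thesis using assms(2) by (auto simp: doms_def)
qed

text \<open>Whichever of two distinct vertices is met first is reached around the other. If each
  dominated the other, neither would ever be reached.\<close>

lemma doms_antisym: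
  assumes "doms x y" "doms y x" "x \<in> insert r W"
  shows "x = y"
proof (rule ccontr)
  assume ne: "x \<noteq> y"
  have r: "r \<noteq> x" "r \<noteq> y" using assms(1,2) doms_rootD ne by metis+
  have "insert r W \<subseteq> reach_avoiding A r {x, y}"
  proof (rule closed_superset)
    show "r \<in> reach_avoiding A r {x, y}" using r by (simp add: reach_avoiding.root)
    fix a b assume a: "a \<in> reach_avoiding A r {x, y}" and ab: "(a, b) \<in> A"
    have "a \<in> reach_avoiding A r {x}" "a \<in> reach_avoiding A r {y}"
      using reach_avoiding_antimono[OF a] by auto
    then have "b \<noteq> y" "b \<noteq> x"
      using ab assms(1,2) doms_pred ne by (auto simp: doms_def)
    then show "b \<in> reach_avoiding A r {x, y}" using a ab by (auto intro: reach_avoiding.step)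
  qed
  then show False using assms(3) reach_avoiding_notin[of x A r "{x, y}"] by auto
qed

text \<open>Otherwise each of \<open>x\<close> and \<open>y\<close> can be reached around the other.
  The union of the two avoiding sets is then closed under arcs, because a step blocked by
  \<open>x\<close> ends in \<open>x\<close>, which lies in the other set; so \<open>v\<close> is in
  the union.\<close>

lemma doms_chain:
  assumes "doms x v" "doms y v" "v \<in> insert r W"
  shows "doms x y \<or> doms y x"
proof (rule ccontr)
  assume no: "\<not> ?thesis"
  have "insert r W \<subseteq> reach_avoiding A r {x} \<union> reach_avoiding A r {y}"
  proof (rule closed_superset)
    show "r \<in> reach_avoiding A r {x} \<union> reach_avoiding A r {y}"
      using no reach_avoiding_root[of y A r "{x}"] by (auto simp: doms_def intro: reach_avoiding.root)
    fix a b assume "a \<in> reach_avoiding A r {x} \<union> reach_avoiding A r {y}" and ab: "(a, b) \<in> A"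
    then show "b \<in> reach_avoiding A r {x} \<union> reach_avoiding A r {y}"
      using no by (cases "b = x \<or> b = y") (auto simp: doms_def intro: reach_avoiding.step)
  qed
  then show False using assms by (auto simp: doms_def)
qed

definition indeg1 :: "'a set" where
  "indeg1 = {v \<in> W. \<exists>u. \<forall>u'. (u', v) \<in> A \<longleftrightarrow> u' = u}"

lemma indeg1_parent:
  assumes "v \<in> indeg1" "(u, v) \<in> A"
  shows "doms u v \<and> (\<forall>u'. (u', v) \<in> A \<longrightarrow> u' = u)"
proof -
  have u: "u' = u" if "(u', v) \<in> A" for u' using assms that by (auto simp: indeg1_def)
  have "v \<notin> reach_avoiding A r {u}"
  proof
    assume "v \<in> reach_avoiding A r {u}"
    then show False
    proof (cases rule: reach_avoiding.cases)
      case root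
      then show ?thesis using assms(1) rW by (simp add: indeg1_def)
    next
      case (step a)
      then show ?thesis using u[of a] reach_avoiding_notin[of a A r "{u}"] by simp
    qed
  qed
  then show ?thesis using u by (simp add: doms_def)
qed

section \<open>Immediate dominators and the dominator tree\<close>

definition strict_doms :: "'a \<Rightarrow> 'a set" where
  "strict_doms v = {x. doms x v \<and> x \<noteq> v}"

definition idom :: "'a \<Rightarrow> 'a" where
  "idom v = (SOME d. d \<in> strict_doms v \<and> (\<forall>x \<in> strict_doms v. doms x d))"

lemma doms_subset: "v \<in> insert r W \<Longrightarrow> {x. doms x v} \<subseteq> insert r W"
  using doms_in by blast

text \<open>By \<open>doms_chain\<close> the strict dominators of \<open>v\<close> form a chain; the
  one with the most dominators is its last element.\<close>

lemma idom:
  assumes v: "v \<in> W"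
  shows "idom v \<in> strict_doms v" "x \<in> strict_doms v \<Longrightarrow> doms x (idom v)"
proof -
  have "r \<in> strict_doms v" using v rW doms_root by (auto simp: strict_doms_def)
  moreover have "\<forall>x. x \<in> strict_doms v \<longrightarrow> card {y. doms y x} < Suc (card (insert r W))"
  proof clarify
    fix x assume "x \<in> strict_doms v"
    then have "x \<in> insert r W" using doms_in[of x v] v by (auto simp: strict_doms_def)
    then have "card {y. doms y x} \<le> card (insert r W)" using doms_subset finW by (intro card_mono) auto
    then show "card {y. doms y x} < Suc (card (insert r W))" by simp
  qed
  ultimately have "\<exists>d. d \<in> strict_doms v \<and> (\<forall>x. x \<in> strict_doms v \<longrightarrow> card {y. doms y x} \<le> card {y. doms y d})"
    by (rule ex_has_greatest_nat)
  then obtain d where d: "d \<in> strict_doms v"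
    and max: "\<And>x. x \<in> strict_doms v \<Longrightarrow> card {y. doms y x} \<le> card {y. doms y d}" by blast
  have "doms x d" if x: "x \<in> strict_doms v" for x
  proof (rule ccontr)
    assume nd: "\<not> doms x d"
    then have dx: "doms d x" using doms_chain[of x v d] d x v by (auto simp: strict_doms_def)
    have "x \<in> insert r W" using x doms_in[of x v] v by (auto simp: strict_doms_def)
    then have "finite {y. doms y x}" using finite_subset[OF doms_subset] finW by auto
    moreover have "{y. doms y d} \<subset> {y. doms y x}"
      using dx nd doms_trans[of _ d x] doms_refl[of x] by auto
    ultimately have "card {y. doms y d} < card {y. doms y x}" by (rule psubset_card_mono)
    then show False using max[OF x] by simp
  qed
  then have "\<exists>d. d \<in> strict_doms v \<and> (\<forall>x \<in> strict_doms v. doms x d)" using d by blast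
  from someI_ex[OF this] show "idom v \<in> strict_doms v" "x \<in> strict_doms v \<Longrightarrow> doms x (idom v)"
    unfolding idom_def by blast+
qed

lemma idom_doms: "v \<in> W \<Longrightarrow> doms (idom v) v \<and> idom v \<noteq> v \<and> idom v \<in> insert r W"
  using idom(1)[of v] doms_in[of "idom v" v] by (auto simp: strict_doms_def)

lemma doms_idom: "v \<in> W \<Longrightarrow> doms x v \<Longrightarrow> x \<noteq> v \<Longrightarrow> doms x (idom v)"
  using idom(2)[of v x] by (simp add: strict_doms_def)

sublocale dtree: rooted_tree W r idom
proof
  show "acyclic (parent_rel W idom)"
  proof (rule acyclic_parent_rel)
    fix v assume v: "v \<in> W"
    then have "finite {y. doms y v}" using finite_subset[OF doms_subset] finW by auto
    moreover have "{y. doms y (idom v)} \<subset> {y. doms y v}"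
    proof
      show "{y. doms y (idom v)} \<subseteq> {y. doms y v}" using idom_doms[OF v] doms_trans[of _ "idom v" v] by auto
      have "\<not> doms v (idom v)" using idom_doms[OF v] doms_antisym[of v "idom v"] v by auto
      then show "{y. doms y (idom v)} \<noteq> {y. doms y v}" using doms_refl[of v] by auto
    qed
    ultimately show "card {y. doms y (idom v)} < card {y. doms y v}" by (rule psubset_card_mono)
  qed
qed (use finW rW idom_doms in auto)

lemma doms_iff_tree:
  assumes "u \<in> insert r W" "v \<in> insert r W"
  shows "doms u v \<longleftrightarrow> (u, v) \<in> (parent_rel W idom)\<^sup>*"
proof
  assume "(u, v) \<in> (parent_rel W idom)\<^sup>*"
  then show "doms u v"
    by induction (auto simp: doms_refl dest: idom_doms intro: doms_trans)
next
  assume "doms u v"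
  with assms(2) show "(u, v) \<in> (parent_rel W idom)\<^sup>*"
  proof (induction v rule: dtree.key_induct)
    case root
    then show ?case using doms_rootD by auto
  next
    case (child v)
    show ?case
    proof (cases "u = v")
      case False
      then have "(u, idom v) \<in> (parent_rel W idom)\<^sup>*" using child doms_idom by auto
      then show ?thesis using child(1) by (simp add: rtrancl.rtrancl_into_rtrancl)
    qed simp
  qed
qed

end

section \<open>Consequences of Rule 4\<close>

locale reduced_flow_graph = flow_graph +
  assumes rule4: "(y, x) \<in> A \<Longrightarrow> y \<in> reach_avoiding A r ({u. (u, x) \<in> A} - {y})"
begin

text \<open>If \<open>v\<close> dominated \<open>y\<close>, every path to \<open>y\<close> would
  enter \<open>v\<close> beforehand, through an in-neighbour other than \<open>y\<close>; Rule 4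
  provides a path to \<open>y\<close> without these.\<close>

lemma no_back_arc:
  assumes "(y, v) \<in> A"
  shows "\<not> doms v y"
proof
  assume "doms v y"
  then have y: "y \<notin> reach_avoiding A r {v}" by (simp add: doms_def)
  define Z where "Z = {u. (u, v) \<in> A} - {y}"
  have "a \<in> reach_avoiding A r {v}" if "a \<in> reach_avoiding A r Z" for a
    using that
  proof (induction rule: reach_avoiding.induct)
    case root
    show ?case using AW[OF assms] rW by (auto intro: reach_avoiding.root)
  next
    case (step a b)
    have "b \<noteq> v"
    proof
      assume "b = v"
      moreover have "a \<noteq> y" using step.IH y by blast
      ultimately show False using reach_avoiding_notin[OF step.hyps(1)] step.hyps(2) by (simp add: Z_def)
    qed
    then show ?case using reach_avoiding.step[OF step.IH step.hyps(2)] by simp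
  qed
  then show False using rule4[OF assms] y by (simp add: Z_def)
qed

text \<open>By Rule 4 another in-neighbour could be reached around \<open>d\<close>, and then so
  could \<open>v\<close>.\<close>

lemma only_in_nbr_if_doms:
  assumes d: "(d, v) \<in> A" "doms d v" and y: "(y, v) \<in> A"
  shows "y = d"
proof (rule ccontr)
  assume "y \<noteq> d"
  then have "y \<in> reach_avoiding A r {d}" using reach_avoiding_antimono[OF rule4[OF y], of "{d}"] d(1) by simp
  then have "\<not> doms d y" by (simp add: doms_def)
  then show False using doms_pred[OF d(2) y] d(1) irrefl by auto
qed

lemma in_indeg1_if_doms: "(d, v) \<in> A \<Longrightarrow> doms d v \<Longrightarrow> v \<in> indeg1"
  using only_in_nbr_if_doms AW unfolding indeg1_def by blast

lemma in_nbr_unrelated: "(u, v) \<in> A \<Longrightarrow> v \<notin> indeg1 \<Longrightarrow> \<not> doms u v \<and> \<not> doms v u"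
  using no_back_arc in_indeg1_if_doms by blast

text \<open>The derived graph on the children of a vertex of the dominator tree: an arc into
  \<open>c\<close> from the subtree of a sibling counts as an arc from that sibling.\<close>

definition sib_nbrs :: "'a \<Rightarrow> 'a set" where
  "sib_nbrs c = {c' \<in> W. idom c' = idom c \<and> (\<exists>u. doms c' u \<and> (u, c) \<in> A)}"

lemma sib_of_in_nbr:
  assumes c: "c \<in> W" "c \<notin> indeg1" and u: "(u, c) \<in> A"
  shows "\<exists>c' \<in> sib_nbrs c. doms c' u"
proof -
  have uV: "u \<in> insert r W" using AW u by blast
  have a: "doms (idom c) u" "idom c \<noteq> u" "idom c \<in> insert r W"
    using idom_doms[OF c(1)] doms_pred u in_nbr_unrelated[OF u c(2)] by auto
  then have "(idom c, u) \<in> (parent_rel W idom)\<^sup>*" using doms_iff_tree uV by blast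
  from parent_rel_rtrancl_child[OF this a(2)] obtain c' where c': "c' \<in> W" "idom c' = idom c"
    "(c', u) \<in> (parent_rel W idom)\<^sup>*" by blast
  then have "doms c' u" using doms_iff_tree uV by blast
  then show ?thesis using c' u by (auto simp: sib_nbrs_def)
qed

text \<open>A path avoiding \<open>Z\<close> never gets below a member of \<open>K - Z\<close>: it
  would have to enter at such a member \<open>c\<close>, but the in-neighbours of \<open>c\<close>
  lie below members of \<open>K - Z\<close> themselves. So \<open>Z\<close> cuts off
  \<open>K - Z\<close>, whereas everything is reachable and no vertex dominates its sibling. This is
  the boundary condition of \<open>low_high_labelling\<close>.\<close>

lemma sib_boundary_subset:
  assumes K: "K \<subseteq> {c \<in> W. idom c = a}" and Z: "Z = {} \<or> (\<exists>x \<in> K. Z = {x})"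
    and bd: "{c \<in> K. c \<in> indeg1 \<or> \<not> sib_nbrs c \<subseteq> K} \<subseteq> Z"
  shows "K \<subseteq> Z"
proof
  have disj: "\<not> doms c b" if "b \<in> reach_avoiding A r Z" "c \<in> K - Z" for b c
    using that
  proof (induction arbitrary: c rule: reach_avoiding.induct)
    case root
    then show ?case using doms_rootD K rW by blast
  next
    case (step b b')
    show ?case
    proof
      assume doms: "doms c b'"
      show False
      proof (cases "b' = c")
        case False
        then show False using doms_pred[OF doms step.hyps(2)] step by blast
      next
        case True
        then have c: "c \<in> W" "c \<notin> indeg1" "sib_nbrs c \<subseteq> K" using bd step.prems K by blast+
        have "(b, c) \<in> A" using step.hyps(2) True by simp
        from sib_of_in_nbr[OF c(1,2) this] obtain c' where c': "c' \<in> sib_nbrs c" "doms c' b" by blast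
        have "c' \<notin> Z" using reach_avoiding_antimono[OF step.hyps(1), of "{c'}"] c'(2) by (auto simp: doms_def)
        then show False using step.IH[of c'] c' c(3) by blast
      qed
    qed
  qed
  fix c assume c: "c \<in> K"
  show "c \<in> Z"
  proof (rule ccontr)
    assume cZ: "c \<notin> Z"
    then have "c \<notin> reach_avoiding A r Z" using disj[of c c] c doms_refl by blast
    moreover have "c \<in> reach_avoiding A r {}" using reach c K by blast
    ultimately obtain x where x: "x \<in> K" "Z = {x}" using Z by blast
    then have "doms x c" using \<open>c \<notin> reach_avoiding A r Z\<close> by (simp add: doms_def)
    moreover have cx: "c \<in> W" "x \<in> W" "idom c = idom x" "x \<noteq> c" using K x c cZ by auto
    ultimately have "doms x (idom x)" using doms_idom[of c x] by simp
    then show False using idom_doms[OF cx(2)] doms_antisym[of x "idom x"] cx(2) by auto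
  qed
qed

text \<open>
  The lexicographic keys along the dominator tree form a low-high order in the sense of Georgiadis
  and Tarjan; \<open>kg\<close> is the key for the reversed order of siblings.
\<close>

lemma low_high_order:
  obtains kf kg :: "'a \<Rightarrow> real list"
  where "\<And>u v. u \<in> insert r W \<Longrightarrow> v \<in> insert r W \<Longrightarrow> doms u v \<longleftrightarrow> kf u \<le> kf v \<and> kg u \<le> kg v"
    "inj_on kf (insert r W)" "inj_on kg (insert r W)"
    "\<And>v. v \<in> W - indeg1 \<Longrightarrow> \<exists>u. (u, v) \<in> A \<and> kf u < kf v"
    "\<And>v. v \<in> W - indeg1 \<Longrightarrow> \<exists>u. (u, v) \<in> A \<and> kg u < kg v"
proof -
  have "\<exists>h :: 'a \<Rightarrow> real. inj_on h {c \<in> W. idom c = a} \<and> (\<forall>c \<in> {c \<in> W. idom c = a} - indeg1. between_nbrs sib_nbrs h c)" for a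
  proof -
    let ?C = "{c \<in> W. idom c = a}"
    have bd: "min 2 (card K) \<le> card {c \<in> K. c \<in> indeg1 \<or> \<not> sib_nbrs c \<subseteq> K}" (is "_ \<le> card ?B")
      if K: "K \<subseteq> ?C" for K
    proof -
      have fin: "finite K" using finite_subset[OF K] finW by simp
      then have finB: "finite ?B" by simp
      consider "card ?B \<ge> 2" | "card ?B = 0" | "card ?B = 1" by linarith
      then show ?thesis
      proof cases
        case 2
        then have "K \<subseteq> {}" using finB by (intro sib_boundary_subset[OF K]) auto
        then show ?thesis by simp
      next
        case 3
        then obtain x where x: "?B = {x}" using card_1_singletonE by blast
        then have "x \<in> K" by blast
        then have "K \<subseteq> {x}" using x by (intro sib_boundary_subset[OF K]) auto
        then have "card K \<le> 1" using card_mono[of "{x}" K] by simp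
        then show ?thesis using 3 by simp
      qed simp
    qed
    show ?thesis
      by (rule low_high_labelling[of ?C sib_nbrs indeg1]) (use finW bd in \<open>auto simp: sib_nbrs_def\<close>)
  qed
  then obtain H :: "'a \<Rightarrow> 'a \<Rightarrow> real" where H': "\<And>a. inj_on (H a) {c \<in> W. idom c = a}
      \<and> (\<forall>c \<in> {c \<in> W. idom c = a} - indeg1. between_nbrs sib_nbrs (H a) c)"
    using choice[of "\<lambda>a h :: 'a \<Rightarrow> real. inj_on h {c \<in> W. idom c = a}
      \<and> (\<forall>c \<in> {c \<in> W. idom c = a} - indeg1. between_nbrs sib_nbrs h c)"] by blast
  then have H: "\<And>a. inj_on (H a) {c \<in> W. idom c = a}"
    "\<And>a c. c \<in> W - indeg1 \<Longrightarrow> idom c = a \<Longrightarrow> between_nbrs sib_nbrs (H a) c" by auto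
  define h where "h = (\<lambda>c. H (idom c) c)"
  define kf where "kf = dtree.key h"
  define kg where "kg = dtree.key (\<lambda>c. - h c)"
  have sib: "u = v" if "u \<in> W" "v \<in> W" "idom u = idom v" "h u = h v" for u v
    using H(1)[of "idom v"] that by (auto simp: h_def inj_on_def)
  then have sib': "u = v" if "u \<in> W" "v \<in> W" "idom u = idom v" "- h u = - h v" for u v
    using that by simp
  \<comment> \<open>The keys of \<open>u\<close> and \<open>v\<close> both extend that of
    \<open>idom v\<close>, by \<open>h' c\<close> and by \<open>h' v\<close>, so the order of
    siblings decides. A general \<open>h'\<close> serves both \<open>h\<close> and its
    negative.\<close>
  have less: "\<exists>u. (u, v) \<in> A \<and> dtree.key h' u < dtree.key h' v"
    if v: "v \<in> W" and c: "c \<in> sib_nbrs v" "h' c < h' v" for v c and h' :: "'a \<Rightarrow> real"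
  proof -
    from c obtain u where u: "c \<in> W" "idom c = idom v" "doms c u" "(u, v) \<in> A" by (auto simp: sib_nbrs_def)
    then have "(c, u) \<in> (parent_rel W idom)\<^sup>*" using doms_iff_tree AW by blast
    then have "prefix (dtree.key h' c) (dtree.key h' u)"
    proof induction
      case (step y z)
      then have "prefix (dtree.key h' y) (dtree.key h' z)" using dtree.key_step[of z h'] by simp
      with step.IH show ?case by (rule prefix_order.trans)
    qed simp
    then obtain ws where "dtree.key h' u = dtree.key h' (idom v) @ (h' c # ws)"
      using dtree.key_step[OF u(1), of h'] u(2) by (auto elim!: prefixE)
    moreover have "dtree.key h' v = dtree.key h' (idom v) @ [h' v]" using dtree.key_step[OF v] .
    ultimately show ?thesis using u(4) less_list_append_left[of "h' c # ws" "[h' v]"] c(2) by auto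
  qed
  show thesis
  proof (rule that[of kf kg])
    fix u v assume uv: "u \<in> insert r W" "v \<in> insert r W"
    have "kg w = map uminus (kf w)" if "w \<in> insert r W" for w
      using dtree.key_map[OF that, of uminus h] by (simp add: kf_def kg_def)
    then have kg: "kg u = map uminus (kf u)" "kg v = map uminus (kf v)" using uv by blast+
    have "prefix (kf u) (kf v) \<longleftrightarrow> (u, v) \<in> (parent_rel W idom)\<^sup>*"
      unfolding kf_def using sib uv by (rule dtree.prefix_key_iff)
    then show "doms u v \<longleftrightarrow> kf u \<le> kf v \<and> kg u \<le> kg v"
      unfolding doms_iff_tree[OF uv] kg using prefix_iff_le_map_uminus[of "kf u" "kf v"] by argo
  next
    show "inj_on kf (insert r W)"
    proof (rule inj_onI)
      fix u v assume "u \<in> insert r W" "v \<in> insert r W" "kf u = kf v"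
      with sib show "u = v" unfolding kf_def by (rule dtree.key_inj)
    qed
    show "inj_on kg (insert r W)"
    proof (rule inj_onI)
      fix u v assume "u \<in> insert r W" "v \<in> insert r W" "kg u = kg v"
      with sib' show "u = v" unfolding kg_def by (rule dtree.key_inj)
    qed
  next
    fix v assume v: "v \<in> W - indeg1"
    have "between_nbrs sib_nbrs (H (idom v)) v" using H(2)[OF v] by simp
    moreover have "H (idom v) c = h c" if "c \<in> insert v (sib_nbrs v)" for c
      using that by (auto simp: h_def sib_nbrs_def)
    ultimately obtain c c' where c: "c \<in> sib_nbrs v" "h c < h v" "c' \<in> sib_nbrs v" "h v < h c'"
      unfolding between_nbrs_def by fastforce
    show "\<exists>u. (u, v) \<in> A \<and> kf u < kf v" unfolding kf_def by (rule less[of v c]) (use v c in auto)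
    show "\<exists>u. (u, v) \<in> A \<and> kg u < kg v" unfolding kg_def by (rule less[of v c']) (use v c in auto)
  qed
qed

end

section \<open>The two trees of a low-high order\<close>

context few_leaves
begin

text \<open>
  An arc to \<open>v\<close> from outside the subtree of \<open>v\<close> goes forward in one of two mutually reversed depth-first
  preorders; switching to arcs that go forward in the same preorder creates no cycle.
\<close>

lemma card_transversal_le:
  assumes fA: "\<And>v. v \<in> W \<Longrightarrow> (f v, v) \<in> A" and acyc: "acyclic (parent_rel W f)"
    and Y: "Y \<subseteq> W" and g: "\<And>v. v \<in> Y \<Longrightarrow> (g v, v) \<in> A \<and> g v \<noteq> f v \<and> (v, g v) \<notin> (parent_rel W f)\<^sup>*"
  shows "card Y \<le> 10 * l"
proof -
  interpret rooted_tree W r f by standard (use finW rW AW fA acyc in blast)+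
  obtain n :: "'a \<Rightarrow> nat" where n: "inj_on n W"
    using finite_imp_inj_to_nat_seg[OF finW] by blast
  \<comment> \<open>Any numbering of the vertices and its negative give two opposite orders of
    siblings; parents precede their children in both preorders.\<close>
  define t1 where "t1 = key (\<lambda>v. real (n v))"
  define t2 where "t2 = key (\<lambda>v. - real (n v))"
  have t2: "t2 v = map uminus (t1 v)" if "v \<in> insert r W" for v
    using key_map[OF that, of uminus "\<lambda>v. real (n v)"] by (simp add: t1_def t2_def)
  have less: "t1 (f v) < t1 v \<and> t2 (f v) < t2 v" if "v \<in> W" for v
    using key_step[OF that, of "\<lambda>v. real (n v)"] key_step[OF that, of "\<lambda>v. - real (n v)"]
      less_list_append_left[of "[]" "[x]" for x :: real]
    by (metis Nil_less_Cons append_Nil2 t1_def t2_def)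
  define Y1 where "Y1 = {v \<in> Y. t1 (g v) < t1 v}"
  define Y2 where "Y2 = {v \<in> Y. t2 (g v) < t2 v}"
  have "card Y1 \<le> 5 * l"
    by (rule card_flippable_le[of f t1 _ g]) (use fA less Y g in \<open>auto simp: Y1_def\<close>)
  moreover have "card Y2 \<le> 5 * l"
    by (rule card_flippable_le[of f t2 _ g]) (use fA less Y g in \<open>auto simp: Y2_def\<close>)
  moreover have "Y \<subseteq> Y1 \<union> Y2"
  proof
    fix v assume v: "v \<in> Y"
    have V: "v \<in> insert r W" "g v \<in> insert r W" using v Y g AW by blast+
    have "u = w" if "u \<in> W" "w \<in> W" "f u = f w" "real (n u) = real (n w)" for u w
      using n that by (auto simp: inj_on_def)
    then have "prefix (t1 v) (t1 (g v)) \<longleftrightarrow> (v, g v) \<in> (parent_rel W f)\<^sup>*"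
      unfolding t1_def using V by (rule prefix_key_iff)
    then have "\<not> prefix (t1 v) (t1 (g v))" using g[OF v] by simp
    then have "\<not> (t1 v \<le> t1 (g v) \<and> t2 v \<le> t2 (g v))"
      unfolding prefix_iff_le_map_uminus t2[OF V(1)] t2[OF V(2)] .
    then show "v \<in> Y1 \<union> Y2" using v by (auto simp: Y1_def Y2_def not_le)
  qed
  moreover have "finite (Y1 \<union> Y2)" using finite_subset[OF Y finW] by (simp add: Y1_def Y2_def)
  ultimately show ?thesis using card_mono[of "Y1 \<union> Y2" Y] card_Un_le[of Y1 Y2] by linarith
qed

end

text \<open>\<open>cut_in\<close> and \<open>cut_out\<close> express Rule 2, since a vertex of
  \<open>W\<close> that dominates another vertex is a cut-vertex.\<close>

locale two_trees = reduced_flow_graph W r A + few_leaves W r A l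
  for W :: "'a set" and r :: 'a and A :: "('a \<times> 'a) set" and l :: nat +
  fixes kf kg :: "'a \<Rightarrow> real list" and pf pb :: "'a \<Rightarrow> 'a"
  assumes doms_iff: "u \<in> insert r W \<Longrightarrow> v \<in> insert r W \<Longrightarrow> doms u v \<longleftrightarrow> kf u \<le> kf v \<and> kg u \<le> kg v"
    and pf: "v \<in> W \<Longrightarrow> (pf v, v) \<in> A \<and> kf (pf v) < kf v"
    and pb: "v \<in> W \<Longrightarrow> (pb v, v) \<in> A \<and> kg (pb v) < kg v"
    and cut_in: "doms p w \<Longrightarrow> w \<noteq> p \<Longrightarrow> p \<in> W \<Longrightarrow> w \<in> W \<Longrightarrow> p \<notin> indeg1"
    and cut_out: "doms p w \<Longrightarrow> w \<noteq> p \<Longrightarrow> p \<in> W \<Longrightarrow> w \<in> W \<Longrightarrow> card {z. (p, z) \<in> A} \<noteq> 1"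
begin

definition special :: "'a set" where "special = {v \<in> W. 3 \<le> card {u. (u, v) \<in> A}}"

abbreviation Tf where "Tf \<equiv> parent_rel W pf"
abbreviation Tb where "Tb \<equiv> parent_rel W pb"

definition transversal_f :: "'a set" where "transversal_f = {v \<in> W - indeg1. (v, pb v) \<notin> Tf\<^sup>*}"
definition transversal_b :: "'a set" where "transversal_b = {v \<in> W - indeg1. (v, pf v) \<notin> Tb\<^sup>*}"

definition exceptional :: "'a set" where
  "exceptional = insert r (special \<union> transversal_f \<union> transversal_b \<union> siblings pf \<union> siblings pb)"

text \<open>All assumptions are symmetric in the two orders, so each count proved for
  \<open>pf\<close> is available for \<open>pb\<close>.\<close>

lemma swap: "two_trees W r A l kg kf pb pf"
  by standard (use doms_iff pf pb cut_in cut_out in \<open>auto simp: conj_commute\<close>)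

lemma indeg1_subset: "indeg1 \<subseteq> W" by (auto simp: indeg1_def)

lemma in_V: "(u, v) \<in> A \<Longrightarrow> u \<in> insert r W" using AW by blast

lemma parents_in_V: "v \<in> W \<Longrightarrow> pf v \<in> insert r W \<and> pb v \<in> insert r W"
  using pf pb in_V by blast

text \<open>Neither of \<open>u\<close> and \<open>v\<close> dominates the other, and dominance is
  the intersection of the two orders, so these rank \<open>u\<close> and \<open>v\<close>
  oppositely.\<close>

lemma in_nbr_order:
  assumes "(u, v) \<in> A" "v \<notin> indeg1"
  shows "kf u < kf v \<longleftrightarrow> kg v < kg u" "kf u < kf v \<or> kg u < kg v"
proof -
  have V: "u \<in> insert r W" "v \<in> insert r W" using AW assms(1) by blast+
  from in_nbr_unrelated[OF assms] doms_iff[OF V] doms_iff[OF V(2,1)]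
  show "kf u < kf v \<longleftrightarrow> kg v < kg u" "kf u < kf v \<or> kg u < kg v"
    by (metis linorder_not_le order_less_imp_le)+
qed

lemma parents_neq: "v \<in> W - indeg1 \<Longrightarrow> pf v \<noteq> pb v"
  using pf[of v] pb[of v] in_nbr_order(1)[of "pf v" v] by force

lemma indeg1_parents:
  assumes "s \<in> indeg1"
  shows "pb s = pf s" "doms (pf s) s" "(u, s) \<in> A \<longleftrightarrow> u = pf s"
proof -
  have "s \<in> W" using assms indeg1_subset by blast
  then have "(pf s, s) \<in> A" "(pb s, s) \<in> A" using pf pb by blast+
  then show "pb s = pf s" "doms (pf s) s" "(u, s) \<in> A \<longleftrightarrow> u = pf s"
    using indeg1_parent[OF assms] by blast+
qed

lemma finite_in_nbrs: "finite {u. (u, v) \<in> A}"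
  by (rule finite_subset[of _ "insert r W"]) (use finW AW in auto)

lemma in_nbrs_nonspecial:
  assumes "(u, v) \<in> A" "v \<notin> special"
  shows "u = pf v \<or> u = pb v"
proof (rule ccontr)
  assume no: "\<not> ?thesis"
  have v: "v \<in> W" using AW assms(1) by blast
  have "v \<notin> indeg1" using indeg1_parents(3)[of v u] assms(1) no by blast
  then have "card {u, pf v, pb v} = 3" using parents_neq[of v] v no by auto
  moreover have "{u, pf v, pb v} \<subseteq> {u. (u, v) \<in> A}" using assms(1) pf[OF v] pb[OF v] by blast
  ultimately have "3 \<le> card {u. (u, v) \<in> A}" using card_mono[OF finite_in_nbrs] by metis
  then show False using assms(2) v by (simp add: special_def)
qed

lemma acyclic_Tf: "acyclic Tf" and acyclic_Tb: "acyclic Tb"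
  using acyclic_parent_rel[of W kf pf] acyclic_parent_rel[of W kg pb] pf pb by blast+

lemma Tf_le: "(u, v) \<in> Tf\<^sup>* \<Longrightarrow> kf u \<le> kf v"
  using parent_rel_rtrancl_less[of W kf pf] pf by blast

lemma Tb_le: "(u, v) \<in> Tb\<^sup>* \<Longrightarrow> kg u \<le> kg v"
  using parent_rel_rtrancl_less[of W kg pb] pb by blast

lemma Tb_less: "(u, v) \<in> Tb\<^sup>* \<Longrightarrow> u \<noteq> v \<Longrightarrow> kg u < kg v"
  using parent_rel_rtranclD[of u v W pb] Tb_le[of u "pb v"] pb[of v] by auto

section \<open>Counting the exceptional vertices\<close>

lemma card_extra_forward_le: "card {v \<in> W. \<exists>u. (u, v) \<in> A \<and> kf u < kf v \<and> u \<noteq> pf v} \<le> 5 * l"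
proof -
  let ?Y = "{v \<in> W. \<exists>u. (u, v) \<in> A \<and> kf u < kf v \<and> u \<noteq> pf v}"
  define g where "g = (\<lambda>v. SOME u. (u, v) \<in> A \<and> kf u < kf v \<and> u \<noteq> pf v)"
  have g: "(g v, v) \<in> A \<and> kf (g v) < kf v \<and> g v \<noteq> pf v" if "v \<in> ?Y" for v
    using that someI_ex[of "\<lambda>u. (u, v) \<in> A \<and> kf u < kf v \<and> u \<noteq> pf v"] by (simp add: g_def)
  show ?thesis by (rule card_flippable_le[of pf kf _ g]) (use pf g in auto)
qed

lemma card_transversal_f_le: "card transversal_f \<le> 10 * l"
proof (rule card_transversal_le[of pf _ pb])
  fix v assume "v \<in> transversal_f"
  then show "(pb v, v) \<in> A \<and> pb v \<noteq> pf v \<and> (v, pb v) \<notin> Tf\<^sup>*"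
    using pb parents_neq[of v] by (auto simp: transversal_f_def)
qed (use pf acyclic_Tf in \<open>auto simp: transversal_f_def\<close>)

text \<open>A third in-neighbour precedes \<open>v\<close> in \<open>kf\<close> or in
  \<open>kg\<close> and is an alternative to \<open>pf v\<close> or \<open>pb v\<close> there; each
  of the two cases costs \<open>5 * l\<close>.\<close>

lemma card_special_le: "card special \<le> 10 * l"
proof -
  interpret sw: two_trees W r A l kg kf pb pf by (rule swap)
  define Xf where "Xf = {v \<in> W. \<exists>u. (u, v) \<in> A \<and> kf u < kf v \<and> u \<noteq> pf v}"
  define Xb where "Xb = {v \<in> W. \<exists>u. (u, v) \<in> A \<and> kg u < kg v \<and> u \<noteq> pb v}"
  have "special \<subseteq> Xf \<union> Xb"
  proof
    fix v assume "v \<in> special"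
    then have v: "v \<in> W" "3 \<le> card {u. (u, v) \<in> A}" by (auto simp: special_def)
    have "\<not> {u. (u, v) \<in> A} \<subseteq> {pf v, pb v}"
    proof
      assume "{u. (u, v) \<in> A} \<subseteq> {pf v, pb v}"
      then have "card {u. (u, v) \<in> A} \<le> card {pf v, pb v}" by (intro card_mono) auto
      also have "\<dots> \<le> 2" by (simp add: card_insert_if)
      finally show False using v(2) by simp
    qed
    then obtain u where u: "(u, v) \<in> A" "u \<noteq> pf v" "u \<noteq> pb v" by blast
    then have "v \<notin> indeg1" using indeg1_parents(3) by blast
    then show "v \<in> Xf \<union> Xb" using in_nbr_order(2)[OF u(1)] u v(1) by (auto simp: Xf_def Xb_def)
  qed
  then have "card special \<le> card (Xf \<union> Xb)" using finW by (intro card_mono) (auto simp: Xf_def Xb_def)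
  moreover have "card Xf \<le> 5 * l" "card Xb \<le> 5 * l"
    using card_extra_forward_le sw.card_extra_forward_le by (simp_all add: Xf_def Xb_def)
  ultimately show ?thesis using card_Un_le[of Xf Xb] by linarith
qed

text \<open>Lets multiples of \<open>l\<close> absorb the additive terms for the root.\<close>

lemma l_pos: "l > 0"
proof -
  have "card (pf ` W) < card (insert r W)"
    using card_image_le[OF finW, of pf] finW rW by simp
  then have "card (insert r W - pf ` W) > 0"
    using diff_card_le_card_Diff[of "pf ` W" "insert r W"] finW by simp
  then show ?thesis using leaves_le[of pf] pf acyclic_Tf by force
qed

lemma finite_exceptional: "finite exceptional"
  using finW by (auto simp: exceptional_def special_def transversal_f_def transversal_b_def siblings_def)

lemma card_exceptional_le: "card exceptional \<le> 35 * l"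
proof -
  interpret sw: two_trees W r A l kg kf pb pf by (rule swap)
  have "transversal_b = sw.transversal_f" by (simp add: transversal_b_def sw.transversal_f_def)
  then have "card transversal_b \<le> 10 * l" using sw.card_transversal_f_le by simp
  moreover have "card (siblings pf) \<le> 2 * l" "card (siblings pb) \<le> 2 * l"
    using card_siblings_le pf pb acyclic_Tf acyclic_Tb by auto
  moreover have "card exceptional \<le> Suc (card (special \<union> transversal_f \<union> transversal_b \<union> siblings pf \<union> siblings pb))"
    unfolding exceptional_def by (rule card_insert_le_m1[THEN order_trans]) auto
  moreover have "card (special \<union> transversal_f \<union> transversal_b \<union> siblings pf \<union> siblings pb)
      \<le> card special + card transversal_f + card transversal_b + card (siblings pf) + card (siblings pb)"
    by (meson card_Un_le add_le_mono order_refl order_trans)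
  \<comment> \<open>35 = 10 + 10 + 10 + 2 + 2 for the five sets, and 1 for the root.\<close>
  ultimately show ?thesis using card_special_le card_transversal_f_le l_pos by linarith
qed

section \<open>Macro vertices and their successors\<close>

lemma not_doms_of_indeg1: "s \<in> indeg1 \<Longrightarrow> doms s w \<Longrightarrow> w \<in> insert r W \<Longrightarrow> w = s"
  using cut_in[of s w] indeg1_subset doms_rootD rW by blast

text \<open>
  A vertex \<open>p\<close> all of whose dominated out-neighbours are \<open>s\<close> dominates only \<open>s\<close>, since otherwise \<open>s\<close>,
  which has in-degree 1, would be a cut-vertex.
\<close>

lemma dominated_only_child:
  assumes s: "s \<in> indeg1" "s \<notin> siblings pf" and w: "doms (pf s) w" "w \<in> insert r W" and p: "pf s \<in> W"
  shows "w = pf s \<or> w = s"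
proof (rule ccontr)
  assume no: "\<not> ?thesis"
  have no_K: "\<not> (doms (pf s) b \<and> b \<noteq> pf s \<and> b \<noteq> s)" if "b \<in> reach_avoiding A r {s}" for b
    using that
  proof (induction rule: reach_avoiding.induct)
    case root
    then show ?case using doms_rootD p rW by auto
  next
    case (step a b)
    show ?case
    proof
      assume b: "doms (pf s) b \<and> b \<noteq> pf s \<and> b \<noteq> s"
      then have "doms (pf s) a" using doms_pred[of "pf s" b a] step.hyps(2) by auto
      moreover have "a \<noteq> s" using reach_avoiding_notin[OF step.hyps(1)] by simp
      ultimately have "a = pf s" using step.IH by blast
      then have "b \<in> indeg1" using in_indeg1_if_doms step.hyps(2) b by blast
      then have "pf b = pf s" using indeg1_parents(3)[of b a] step.hyps(2) \<open>a = pf s\<close> by simp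
      then have "b = s" using siblings_inj[of s pf b] s indeg1_subset \<open>b \<in> indeg1\<close> by blast
      then show False using b by simp
    qed
  qed
  then have "doms s w" using no w(1) by (auto simp: doms_def)
  then show False using not_doms_of_indeg1 s(1) w(2) no by blast
qed

text \<open>
  A vertex \<open>v \<notin> indeg1\<close> and its child in \<open>indeg1\<close> (if any) form a macro vertex, which is entered at \<open>v\<close> and left
  at \<open>out_end v\<close>. The choice is unique unless the child has siblings, and then \<open>v \<notin> good\<close>.
\<close>

definition out_end :: "'a \<Rightarrow> 'a" where
  "out_end v = (if \<exists>s \<in> indeg1. pf s = v then SOME s. s \<in> indeg1 \<and> pf s = v else v)"

definition in_end :: "'a \<Rightarrow> 'a" where
  "in_end x = (if x \<in> indeg1 then pf x else x)"

definition good :: "'a set" where "good = {v \<in> W - indeg1. v \<notin> exceptional \<and> out_end v \<notin> exceptional}"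

lemma out_end_cases:
  obtains "out_end v = v" "\<And>s. s \<in> indeg1 \<Longrightarrow> pf s \<noteq> v" | "out_end v \<in> indeg1" "pf (out_end v) = v" "pb (out_end v) = v"
proof (cases "\<exists>s \<in> indeg1. pf s = v")
  case True
  then have "\<exists>s. s \<in> indeg1 \<and> pf s = v" by blast
  from someI_ex[OF this] have "out_end v \<in> indeg1 \<and> pf (out_end v) = v" using True by (simp add: out_end_def)
  then show ?thesis using that(2) indeg1_parents(1) by simp
next
  case False
  then show ?thesis using that(1) by (auto simp: out_end_def)
qed

lemma in_end_out_end: "v \<notin> indeg1 \<Longrightarrow> in_end (out_end v) = v"
  by (cases v rule: out_end_cases) (auto simp: in_end_def)

lemma out_end_in_W: "v \<in> W \<Longrightarrow> out_end v \<in> W"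
  by (cases v rule: out_end_cases) (use indeg1_subset in auto)

text \<open>Subtrees of the dominator tree are intervals of \<open>kg\<close>. If \<open>x\<close>
  were outside the subtree of \<open>a\<close>, it would precede \<open>a\<close> and hence
  \<open>u\<close> in \<open>kf\<close>, so it would dominate \<open>u\<close> and therefore
  \<open>a\<close>, against \<open>kg a < kg x\<close>.\<close>

lemma doms_between:
  assumes "doms a u" "a \<in> insert r W" "u \<in> insert r W" "x \<in> insert r W" "kg a < kg x" "kg x \<le> kg u"
  shows "doms a x"
proof (rule ccontr)
  assume no: "\<not> doms a x"
  then have "kf x < kf a" using doms_iff[of a x] assms by auto
  moreover have "kf a \<le> kf u" using doms_iff[of a u] assms by auto
  ultimately have "doms x u" using doms_iff[of x u] assms by auto
  then have "doms x a" using doms_chain[OF assms(1)] assms(3) no by blast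
  then show False using doms_iff[of x a] assms by auto
qed

text \<open>
  Let \<open>w\<close> follow \<open>out_end v\<close> on the path in \<open>Tb\<close> from \<open>v\<close> to \<open>u = pf v\<close>. If \<open>out_end w \<noteq> u\<close>, then \<open>w\<close> lies strictly
  between \<open>u\<close> and \<open>v\<close> in the order \<open>kf\<close>, so \<open>v\<close> is not below \<open>w\<close> in \<open>Tf\<close>, and \<open>w\<close> is exceptional.
\<close>

lemma next_in_end:
  assumes v: "v \<in> good"
  obtains w where "w \<in> W - indeg1" "pb w = out_end v" "w \<in> good \<Longrightarrow> out_end w = pf v"
proof -
  define u where "u = pf v"
  have vW: "v \<in> W" "v \<notin> indeg1" and v0: "v \<notin> exceptional" "out_end v \<notin> exceptional" using v by (auto simp: good_def)
  have uv: "(u, v) \<in> A" "kf u < kf v" using pf vW by (auto simp: u_def)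
  have uV: "u \<in> insert r W" using in_V uv by blast
  have uTb: "(v, u) \<in> Tb\<^sup>*" using vW v0 by (auto simp: exceptional_def transversal_b_def u_def)
  have "u \<noteq> v" using uv(1) irrefl by blast
  \<comment> \<open>The path leaves the macro vertex through its out-end: if this is not
    \<open>v\<close>, it has no sibling in \<open>Tb\<close> and so is the only child of
    \<open>v\<close> there.\<close>
  have out_end_u: "(out_end v, u) \<in> Tb\<^sup>* \<and> out_end v \<noteq> u"
  proof (cases v rule: out_end_cases)
    case 1
    then show ?thesis using uTb \<open>u \<noteq> v\<close> by simp
  next
    case 2
    obtain c where c: "c \<in> W" "pb c = v" "(c, u) \<in> Tb\<^sup>*"
      using parent_rel_rtrancl_child[OF uTb] \<open>u \<noteq> v\<close> by blast
    have "out_end v \<notin> siblings pb" using v0 by (auto simp: exceptional_def)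
    then have "c = out_end v" using siblings_inj[of "out_end v" pb c] out_end_in_W vW(1) 2 c by simp
    moreover have "out_end v \<noteq> u" using no_back_arc[OF uv(1)] indeg1_parents(2)[OF 2(1)] 2(2) by auto
    ultimately show ?thesis using c by simp
  qed
  then obtain w where w: "w \<in> W" "pb w = out_end v" "(w, u) \<in> Tb\<^sup>*"
    using parent_rel_rtrancl_child[of "out_end v" u W pb] by blast
  have pbw: "(out_end v, w) \<in> A" "kg (out_end v) < kg w" using pb[OF w(1)] w(2) by auto
  have wS: "w \<notin> indeg1"
  proof
    assume wS: "w \<in> indeg1"
    then have pfw: "pf w = out_end v" using indeg1_parents(1) w(2) by simp
    show False
    proof (cases v rule: out_end_cases)
      case 1
      then show False using wS pfw by simp
    next
      case 2
      then have "doms (out_end v) w" using indeg1_parents(2)[OF wS] pfw by simp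
      then have "w = out_end v" using not_doms_of_indeg1[OF 2(1)] w(1) by blast
      then show False using pbw(1) irrefl by simp
    qed
  qed
  have kg_v: "kg v \<le> kg (out_end v)" "kg v < kg w"
  proof -
    show "kg v \<le> kg (out_end v)"
    proof (cases v rule: out_end_cases)
      case 2
      then have "out_end v \<in> W" using indeg1_subset by blast
      then show ?thesis using pb[of "out_end v"] 2(3) by (simp add: less_imp_le)
    qed simp
    then show "kg v < kg w" using pbw(2) by (rule order.strict_trans1)
  qed
  have "out_end w = u" if wG: "w \<in> good"
  proof (cases "w = u")
    case True
    show ?thesis
    proof (cases u rule: out_end_cases)
      case 2
      have "v \<notin> siblings pf" using v0 by (auto simp: exceptional_def)
      then have "out_end u = v" using siblings_inj[of v pf "out_end u"] vW 2 indeg1_subset by (auto simp: u_def)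
      then show ?thesis using 2 vW by simp
    qed (use True in simp)
  next
    case False
    have w0: "w \<notin> exceptional" "out_end w \<notin> exceptional" using wG by (auto simp: good_def)
    have kgwu: "kg w < kg u" using Tb_less[OF w(3)] False by simp
    show ?thesis
    proof (cases "doms w u")
      case True
      \<comment> \<open>The next vertex \<open>c\<close> on the path is dominated by
        \<open>w\<close> as well, so \<open>w\<close> has a child in \<open>indeg1\<close>. Then
        \<open>w\<close> dominates only itself and \<open>out_end w\<close>, which leaves
        \<open>u = out_end w\<close>.\<close>
      obtain c where c: "c \<in> W" "pb c = w" "(c, u) \<in> Tb\<^sup>*"
        using parent_rel_rtrancl_child[OF w(3) False] by blast
      have cw: "(w, c) \<in> A" "kg w < kg c" using pb[OF c(1)] c(2) by auto
      have "doms w c" using doms_between[OF True] w(1) uV c(1) cw(2) Tb_le[OF c(3)] by blast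
      then have "c \<in> indeg1" using in_indeg1_if_doms cw(1) by blast
      then have "pf c = w" using indeg1_parents(1) c(2) by simp
      then have tw: "out_end w \<in> indeg1" "pf (out_end w) = w"
        by (cases w rule: out_end_cases; use \<open>c \<in> indeg1\<close> in blast)+
      have "out_end w \<notin> siblings pf" using w0 by (auto simp: exceptional_def)
      then have "u = w \<or> u = out_end w" using dominated_only_child[OF tw(1), of u] tw(2) True uV w(1) by simp
      then show ?thesis using False by blast
    next
      case ndom: False
      then have kf1: "kf u < kf w" using doms_iff[of w u] w(1) uV kgwu by auto
      have "\<not> doms v w"
      proof (cases v rule: out_end_cases)
        case 1
        then show ?thesis using in_indeg1_if_doms pbw(1) wS by metis
      next
        case 2
        have "out_end v \<notin> siblings pf" using v0 by (auto simp: exceptional_def)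
        then have "w = v \<or> w = out_end v" if "doms v w"
          using dominated_only_child[OF 2(1), of w] 2(2) that w(1) vW(1) by simp
        then show ?thesis using kg_v(2) 2(1) wS by auto
      qed
      then have kf2: "kf w < kf v" using doms_iff[of v w] w(1) vW(1) kg_v(2) by auto
      \<comment> \<open>As \<open>w\<close> is not in \<open>transversal_f\<close>, its
        \<open>Tb\<close>-parent \<open>out_end v\<close> lies below it in \<open>Tf\<close>.
        Climbing from there through \<open>v\<close> to \<open>u = pf v\<close> stays below
        \<open>w\<close>, against \<open>kf1\<close>.\<close>
      have "(w, out_end v) \<in> Tf\<^sup>*" using w0 w wS by (auto simp: exceptional_def transversal_f_def)
      moreover have "w \<noteq> out_end v" using pbw(1) irrefl by blast
      ultimately have "(w, v) \<in> Tf\<^sup>*"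
        by (cases v rule: out_end_cases) (auto dest: parent_rel_rtranclD)
      moreover have "w \<noteq> v" using kf2 by auto
      ultimately have "(w, u) \<in> Tf\<^sup>*" using parent_rel_rtranclD[of w v W pf] by (auto simp: u_def)
      then show ?thesis using Tf_le kf1 by fastforce
    qed
  qed
  then show thesis using that w wS by (simp add: u_def)
qed

end

section \<open>Chains of macro vertices\<close>

locale two_trees_rule3 = two_trees +
  assumes rule3: "inj_on u {1..5 :: nat} \<Longrightarrow> u ` {1..5} \<subseteq> insert r W \<Longrightarrow>
      (\<And>i. i \<in> {2, 3, 4} \<Longrightarrow> {z. (u i, z) \<in> A} = {u (i - 1), u (i + 1)} \<and>
         {z. (z, u i) \<in> A} = {u (i - 1), u (i + 1)}) \<Longrightarrow> False"
begin

definition prev :: "'a \<Rightarrow> 'a" where "prev v = in_end (pf v)"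
definition succ :: "'a \<Rightarrow> 'a" where "succ v = in_end (pb v)"

text \<open>The two equations give arcs in both directions between consecutive macro vertices, each
  from an out-end to an in-end.\<close>

definition linked :: "'a set" where
  "linked = {v \<in> good. prev v \<in> good \<and> pf v = out_end (prev v) \<and> pb (prev v) = out_end v}"

lemma goodD: "v \<in> good \<Longrightarrow> v \<in> W \<and> v \<notin> indeg1 \<and> v \<notin> special \<and> v \<notin> siblings pf \<and> v \<notin> siblings pb
    \<and> out_end v \<in> W \<and> out_end v \<notin> special \<and> out_end v \<notin> siblings pf \<and> out_end v \<notin> siblings pb"
  using out_end_in_W[of v] by (auto simp: good_def exceptional_def)

lemma linkedD: "v \<in> linked \<Longrightarrow> v \<in> good \<and> prev v \<in> good \<and> pf v = out_end (prev v) \<and> pb (prev v) = out_end v"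
  by (simp add: linked_def)

lemma finite_good: "finite good" using finW by (simp add: good_def)

lemma succ_prev: "v \<in> linked \<Longrightarrow> succ (prev v) = v"
  using linkedD[of v] goodD[of v] in_end_out_end[of v] by (simp add: succ_def)

lemma in_end_self: "v \<notin> indeg1 \<Longrightarrow> in_end v = v"
  by (simp add: in_end_def)

lemma kf_out_end: "v \<in> W \<Longrightarrow> kf v \<le> kf (out_end v)"
proof (cases v rule: out_end_cases)
  case 2
  then have "out_end v \<in> W" using indeg1_subset by blast
  then show ?thesis using pf[of "out_end v"] 2(2) by (simp add: less_imp_le)
qed simp

lemma kf_prev: "v \<in> linked \<Longrightarrow> kf (prev v) < kf v"
  using kf_out_end[of "prev v"] pf[of v] linkedD[of v] goodD[of v] goodD[of "prev v"] by auto

text \<open>Where a chain breaks, \<open>v\<close> is recovered as \<open>in_end (pb w)\<close> from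
  the \<open>w\<close> of \<open>next_in_end\<close>. That \<open>w\<close> is exceptional or the
  in-end of an exceptional vertex, hence 2 * 35.\<close>

lemma card_starts_le: "card (good - linked) \<le> 70 * l"
proof -
  let ?f = "\<lambda>w. in_end (pb w)"
  have "good - linked \<subseteq> ?f ` (exceptional \<union> in_end ` exceptional)"
  proof
    fix v assume v: "v \<in> good - linked"
    then have vG: "v \<in> good" by blast
    obtain w where w: "w \<in> W - indeg1" "pb w = out_end v" "w \<in> good \<Longrightarrow> out_end w = pf v"
      using next_in_end[OF vG] by blast
    have "w \<notin> good"
    proof
      assume wG: "w \<in> good"
      then have "prev v = w" using w in_end_out_end[of w] by (auto simp: prev_def)
      then have "v \<in> linked" using vG wG w by (simp add: linked_def)
      then show False using v by blast
    qed
    then have "w \<in> exceptional \<or> out_end w \<in> exceptional" using w(1) by (auto simp: good_def)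
    moreover have "w = in_end (out_end w)" using in_end_out_end w(1) by simp
    ultimately have "w \<in> exceptional \<union> in_end ` exceptional" by blast
    moreover have "v = ?f w" using w(2) in_end_out_end[of v] goodD[OF vG] by simp
    ultimately show "v \<in> ?f ` (exceptional \<union> in_end ` exceptional)" by blast
  qed
  then have "card (good - linked) \<le> card (?f ` (exceptional \<union> in_end ` exceptional))" using finite_exceptional by (intro card_mono) auto
  also have "\<dots> \<le> card (exceptional \<union> in_end ` exceptional)" using finite_exceptional by (intro card_image_le) auto
  also have "\<dots> \<le> card exceptional + card (in_end ` exceptional)" by (rule card_Un_le)
  also have "\<dots> \<le> card exceptional + card exceptional" using card_image_le[OF finite_exceptional] by simp
  finally show ?thesis using card_exceptional_le by simp
qed

section \<open>Marked macro vertices and Rule 3\<close>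

definition marked :: "'a set" where
  "marked = {v \<in> good. \<exists>x \<in> special. (v, x) \<in> A \<or> (out_end v, x) \<in> A}"

text \<open>Here \<open>v\<close> is a cut-vertex, so by Rule 2 it has an out-neighbour other than
  \<open>out_end v\<close>. If that one were not special, \<open>v\<close> would be one of its two
  parents and \<open>out_end v\<close> would have a sibling.\<close>

lemma marked_if_out_end:
  assumes v: "v \<in> good" and "out_end v \<noteq> v"
  shows "v \<in> marked"
proof (cases v rule: out_end_cases)
  case 2
  note g = goodD[OF v]
  have "card {z. (v, z) \<in> A} \<noteq> 1"
    using cut_out[of v "out_end v"] indeg1_parents(2)[OF 2(1)] 2 assms(2) g indeg1_subset by auto
  moreover have "(v, out_end v) \<in> A" using indeg1_parents(3)[OF 2(1)] 2(2) by simp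
  ultimately have "{z. (v, z) \<in> A} \<noteq> {out_end v}" by auto
  then obtain z where z: "(v, z) \<in> A" "z \<noteq> out_end v" using \<open>(v, out_end v) \<in> A\<close> by auto
  have "z \<in> special"
  proof (rule ccontr)
    assume "z \<notin> special"
    then have "pf z = v \<or> pb z = v" using in_nbrs_nonspecial z(1) by blast
    moreover have "z \<in> W" using AW z(1) by blast
    ultimately show False
      using siblings_inj[of "out_end v" pf z] siblings_inj[of "out_end v" pb z] g 2 z(2) by auto
  qed
  then show ?thesis using v z(1) by (auto simp: marked_def)
qed (use assms in simp)

text \<open>All three macro vertices are single vertices. An out-neighbour of \<open>w\<close> is
  not special, so it is a child of \<open>w\<close> in \<open>Tf\<close> or \<open>Tb\<close>;
  without siblings these children are \<open>b\<close> and \<open>prev w\<close>.\<close>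

lemma unmarked_nbrs:
  assumes w: "w \<in> linked" and b: "b \<in> linked" "prev b = w"
    and un: "w \<notin> marked" "prev w \<notin> marked" "b \<notin> marked"
  shows "{z. (w, z) \<in> A} = {prev w, b}" "{z. (z, w) \<in> A} = {prev w, b}"
proof -
  define a where "a = prev w"
  note gw = linkedD[OF w] and gb = linkedD[OF b(1)]
  have good: "a \<in> good" "w \<in> good" "b \<in> good" using gw gb by (auto simp: a_def)
  have t: "out_end a = a" "out_end w = w" "out_end b = b"
    using marked_if_out_end good un by (auto simp: a_def)
  have p: "pf w = a" "pb a = w" "pf b = w" "pb w = b" using gw gb t b(2) by (auto simp: a_def)
  note goodD[OF good(1)] goodD[OF good(2)] goodD[OF good(3)]
  note g = this
  have "z = a \<or> z = b" if z: "(w, z) \<in> A" for z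
  proof -
    have "z \<notin> special" using un(1) good(2) z by (auto simp: marked_def)
    then have "pf z = w \<or> pb z = w" using in_nbrs_nonspecial z by blast
    moreover have "z \<in> W" using AW z by blast
    ultimately show ?thesis using siblings_inj[of b pf z] siblings_inj[of a pb z] g p by auto
  qed
  moreover have "(w, a) \<in> A" "(w, b) \<in> A" using pb[of a] pf[of b] p g by auto
  ultimately show "{z. (w, z) \<in> A} = {prev w, b}" unfolding a_def[symmetric] by blast
  have "(a, w) \<in> A" "(b, w) \<in> A" using pf[of w] pb[of w] p g by auto
  moreover have "z = a \<or> z = b" if "(z, w) \<in> A" for z using in_nbrs_nonspecial[OF that] p g by auto
  ultimately show "{z. (z, w) \<in> A} = {prev w, b}" unfolding a_def[symmetric] by blast
qed

lemma no_five_unmarked: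
  assumes u: "u4 \<in> linked" "u3 \<in> linked" "u2 \<in> linked" "u5 \<in> linked" and p: "prev u5 = u4" "prev u4 = u3" "prev u3 = u2" "prev u2 = u1"
    and un: "u1 \<notin> marked" "u2 \<notin> marked" "u3 \<notin> marked" "u4 \<notin> marked" "u5 \<notin> marked"
  shows False
proof -
  define f where "f = (\<lambda>i :: nat. if i = 1 then u1 else if i = 2 then u2 else if i = 3 then u3 else if i = 4 then u4 else u5)"
  have kf: "kf u1 < kf u2" "kf u2 < kf u3" "kf u3 < kf u4" "kf u4 < kf u5" using kf_prev u p by metis+
  have set: "{1..5 :: nat} = {1, 2, 3, 4, 5}" by auto
  have "inj_on f {1..5}" using kf unfolding set f_def by (auto simp: inj_on_def)
  moreover have "f ` {1..5} \<subseteq> insert r W"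
    using linkedD goodD u p unfolding set f_def by (auto simp: image_iff)
  ultimately show False
  proof (rule rule3)
    have f: "f 1 = u1" "f 2 = u2" "f 3 = u3" "f 4 = u4" "f 5 = u5" by (simp_all add: f_def)
    fix i :: nat assume "i \<in> {2, 3, 4}"
    then consider "i = 2" | "i = 3" | "i = 4" by blast
    moreover have "{z. (u2, z) \<in> A} = {u1, u3}" "{z. (z, u2) \<in> A} = {u1, u3}"
      using unmarked_nbrs[of u2 u3] u p un by simp_all
    moreover have "{z. (u3, z) \<in> A} = {u2, u4}" "{z. (z, u3) \<in> A} = {u2, u4}"
      using unmarked_nbrs[of u3 u4] u p un by simp_all
    moreover have "{z. (u4, z) \<in> A} = {u3, u5}" "{z. (z, u4) \<in> A} = {u3, u5}"
      using unmarked_nbrs[of u4 u5] u p un by simp_all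
    ultimately show "{z. (f i, z) \<in> A} = {f (i - 1), f (i + 1)} \<and> {z. (z, f i) \<in> A} = {f (i - 1), f (i + 1)}"
      by cases (simp_all only: f, simp_all add: f f[unfolded One_nat_def])
  qed
qed

text \<open>By Rule 3, going back at most four steps from any good vertex meets a marked vertex or
  the start of a chain; \<open>succ\<close> retraces these steps, so each such vertex accounts for
  at most five good ones.\<close>

lemma card_good_le: "card good \<le> 5 * (card marked + card (good - linked))"
proof -
  define T where "T = marked \<union> (good - linked)"
  define T' where "T' = T \<union> succ ` T \<union> succ ` succ ` T \<union> succ ` succ ` succ ` T \<union> succ ` succ ` succ ` succ ` T"
  have finT: "finite T" using finite_good by (simp add: T_def marked_def)
  have "good \<subseteq> T'"
  proof (rule ccontr)
    assume "\<not> good \<subseteq> T'"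
    then obtain v where v: "v \<in> good" "v \<notin> T'" by blast
    define v1 where "v1 = prev v"
    define v2 where "v2 = prev v1"
    define v3 where "v3 = prev v2"
    define v4 where "v4 = prev v3"
    have good: "w \<in> linked" "w \<notin> marked" if "w \<in> good" "w \<notin> T" for w using that by (auto simp: T_def)
    have 0: "v \<in> linked" "v \<notin> marked" using good[OF v(1)] v(2) by (auto simp: T'_def)
    have s0: "v = succ v1" and G1: "v1 \<in> good" using succ_prev[OF 0(1)] linkedD[OF 0(1)] by (auto simp: v1_def)
    have 1: "v1 \<in> linked" "v1 \<notin> marked" using good[OF G1] v(2) unfolding T'_def s0 by blast+
    have s1: "v1 = succ v2" and G2: "v2 \<in> good" using succ_prev[OF 1(1)] linkedD[OF 1(1)] by (auto simp: v2_def)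
    have 2: "v2 \<in> linked" "v2 \<notin> marked" using good[OF G2] v(2) unfolding T'_def s0 s1 by blast+
    have s2: "v2 = succ v3" and G3: "v3 \<in> good" using succ_prev[OF 2(1)] linkedD[OF 2(1)] by (auto simp: v3_def)
    have 3: "v3 \<in> linked" "v3 \<notin> marked" using good[OF G3] v(2) unfolding T'_def s0 s1 s2 by blast+
    have s3: "v3 = succ v4" and G4: "v4 \<in> good" using succ_prev[OF 3(1)] linkedD[OF 3(1)] by (auto simp: v4_def)
    have 4: "v4 \<notin> marked" using good[OF G4] v(2) unfolding T'_def s0 s1 s2 s3 by blast
    show False
      by (rule no_five_unmarked[of v1 v2 v3 v v4])
        (use 0 1 2 3 4 in \<open>auto simp: v1_def[symmetric] v2_def[symmetric] v3_def[symmetric] v4_def[symmetric]\<close>)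
  qed
  then have "card good \<le> card T'" using finT by (intro card_mono) (auto simp: T'_def)
  also have "\<dots> \<le> card T + card (succ ` T) + card (succ ` succ ` T) + card (succ ` succ ` succ ` T)
      + card (succ ` succ ` succ ` succ ` T)"
    unfolding T'_def by (meson card_Un_le add_le_mono order_refl order_trans)
  also have "\<dots> \<le> 5 * card T"
  proof -
    have im: "card (succ ` branch_set) \<le> card branch_set" if "finite branch_set" for branch_set using that by (rule card_image_le)
    have "card (succ ` T) \<le> card T" "card (succ ` succ ` T) \<le> card (succ ` T)"
      "card (succ ` succ ` succ ` T) \<le> card (succ ` succ ` T)"
      "card (succ ` succ ` succ ` succ ` T) \<le> card (succ ` succ ` succ ` T)"
      using finT by (intro im finite_imageI; assumption)+
    then show ?thesis by linarith
  qed
  also have "card T \<le> card marked + card (good - linked)" unfolding T_def by (rule card_Un_le)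
  finally show ?thesis by simp
qed

section \<open>Chains and their arcs to special vertices\<close>

abbreviation chain_rel where "chain_rel \<equiv> parent_rel linked prev"

definition chain :: "'a \<Rightarrow> 'a set" where "chain c = {v. (c, v) \<in> chain_rel\<^sup>*}"

lemma chain_in_good: "c \<in> good \<Longrightarrow> v \<in> chain c \<Longrightarrow> v \<in> good"
  using linkedD parent_rel_rtranclD[of c v linked prev] by (auto simp: chain_def)

lemma ex_chain:
  assumes "v \<in> good"
  shows "\<exists>c \<in> good - linked. v \<in> chain c"
proof -
  have "acyclic chain_rel" using acyclic_parent_rel[of linked kf prev] kf_prev by blast
  moreover have "finite linked" using finite_subset[of linked good] finite_good by (auto simp: linked_def)
  ultimately have wf: "wf chain_rel" by (intro finite_acyclic_wf finite_parent_rel)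
  from assms show ?thesis
  proof (induction v rule: wf_induct_rule[OF wf])
    case (1 v)
    show ?case
    proof (cases "v \<in> linked")
      case True
      then obtain c where c: "c \<in> good - linked" "(c, prev v) \<in> chain_rel\<^sup>*" using 1 linkedD by (auto simp: chain_def)
      have "(prev v, v) \<in> chain_rel" using True by simp
      with c(2) have "(c, v) \<in> chain_rel\<^sup>*" by (rule rtrancl.rtrancl_into_rtrancl)
      then show ?thesis using c(1) by (auto simp: chain_def)
    qed (use 1 in \<open>auto simp: chain_def\<close>)
  qed
qed

lemma chain_unique:
  assumes "v \<in> chain c" "v \<in> chain c'" "c \<notin> linked" "c' \<notin> linked"
  shows "c' = c"
proof -
  have "(c, v) \<in> chain_rel\<^sup>*" using assms by (simp add: chain_def)
  then have "(c', v) \<in> chain_rel\<^sup>* \<longrightarrow> c' = c"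
  proof induction
    case base
    show ?case using parent_rel_rtranclD[of c' c linked prev] assms(3) by blast
  next
    case (step y z)
    then show ?case using parent_rel_rtranclD[of c' z linked prev] assms(4) by auto
  qed
  then show ?thesis using assms(2) by (simp add: chain_def)
qed

text \<open>By \<open>succ_prev\<close> the map \<open>prev\<close> is injective on
  \<open>linked\<close>, so chains do not branch.\<close>

lemma chain_linear:
  assumes "v \<in> chain c" "v' \<in> chain c"
  shows "(v, v') \<in> chain_rel\<^sup>* \<or> (v', v) \<in> chain_rel\<^sup>*"
proof -
  have "(c, v) \<in> chain_rel\<^sup>*" using assms by (simp add: chain_def)
  then show ?thesis
  proof induction
    case base
    then show ?case using assms(2) by (simp add: chain_def)
  next
    case (step y z)
    have z: "z \<in> linked" "prev z = y" using step.hyps(2) by auto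
    from step.IH show ?case
    proof
      assume yv: "(y, v') \<in> chain_rel\<^sup>*"
      show ?thesis
      proof (cases "y = v'")
        case True
        then show ?thesis using step.hyps(2) by blast
      next
        case False
        then obtain w where w: "w \<in> linked" "prev w = y" "(w, v') \<in> chain_rel\<^sup>*"
          using parent_rel_rtrancl_child[OF yv] by blast
        then have "w = z" using succ_prev z by metis
        then show ?thesis using w by simp
      qed
    next
      assume "(v', y) \<in> chain_rel\<^sup>*"
      then show ?thesis using step.hyps(2) by (meson rtrancl.rtrancl_into_rtrancl)
    qed
  qed
qed

lemma in_nbrs_out_end:
  assumes "out_end v \<noteq> v" "(b, out_end v) \<in> A"
  shows "b = v"
  by (cases v rule: out_end_cases) (use assms indeg1_parents(3) in auto)

text \<open>
  Rule 4 for the middle one of three arcs into \<open>x\<close>: the part of a chain between two macro vertices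
  can only be entered through one of them.
\<close>

lemma no_three_in_chain:
  assumes v1: "v1 \<in> good" and L12: "(v1, v2) \<in> chain_rel\<^sup>*" and L23: "(v2, v3) \<in> chain_rel\<^sup>*" and ne: "v1 \<noteq> v2" "v2 \<noteq> v3" "v1 \<noteq> v3"
    and y: "y1 \<in> {v1, out_end v1}" "y2 \<in> {v2, out_end v2}" "y3 \<in> {v3, out_end v3}"
    and x: "(y1, x) \<in> A" "(y2, x) \<in> A" "(y3, x) \<in> A"
  shows False
proof -
  define I where "I = {w. w \<noteq> v1 \<and> w \<noteq> v3 \<and> (v1, w) \<in> chain_rel\<^sup>* \<and> (w, v3) \<in> chain_rel\<^sup>*}"
  \<comment> \<open>Arcs into the interior \<open>I\<close> come from \<open>I\<close>, its
    out-ends, or the out-ends of \<open>v1\<close> and \<open>v3\<close>. The latter, where they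
    differ from \<open>y1\<close> and \<open>y3\<close>, are entered only from
    \<open>v1 = y1\<close> or \<open>v3 = y3\<close>, so removing \<open>y1\<close> and
    \<open>y3\<close> closes the region.\<close>
  define J where "J = (I \<union> out_end ` I \<union> {out_end v1, out_end v3}) - {y1, y3}"
  have v2: "v2 \<in> good" "v2 \<in> I" using parent_rel_rtranclD[OF L12] linkedD ne L12 L23 by (auto simp: I_def)
  have v3: "v3 \<in> good" using parent_rel_rtranclD[OF L23] linkedD ne by auto
  have IG: "w \<in> linked \<and> prev w \<in> insert v1 I" if "w \<in> I" for w
  proof -
    have w: "(v1, w) \<in> chain_rel\<^sup>*" "w \<noteq> v1" "(w, v3) \<in> chain_rel\<^sup>*" using that by (auto simp: I_def)
    have w': "w \<in> linked" "(v1, prev w) \<in> chain_rel\<^sup>*" using parent_rel_rtranclD[OF w(1)] w(2) by auto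
    have "(prev w, w) \<in> chain_rel" using w'(1) by simp
    then have "(prev w, v3) \<in> chain_rel\<^sup>*" using w(3) by (meson converse_rtrancl_into_rtrancl)
    moreover have "kf (prev w) < kf v3"
      using kf_prev[OF w'(1)] parent_rel_rtrancl_less[of linked kf prev w v3] kf_prev w(3) by fastforce
    ultimately show ?thesis using w' by (auto simp: I_def)
  qed
  have I_succ: "\<exists>b \<in> linked. prev b = w \<and> b \<in> insert v3 I" if "w \<in> I" for w
  proof -
    have w: "(v1, w) \<in> chain_rel\<^sup>*" "(w, v3) \<in> chain_rel\<^sup>*" "w \<noteq> v3" using that by (auto simp: I_def)
    obtain b where b: "b \<in> linked" "prev b = w" "(b, v3) \<in> chain_rel\<^sup>*"
      using parent_rel_rtrancl_child[OF w(2,3)] by blast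
    have "(w, b) \<in> chain_rel" using b by simp
    then have "(v1, b) \<in> chain_rel\<^sup>*" using w(1) by (meson rtrancl.rtrancl_into_rtrancl)
    moreover have "kf v1 < kf b"
      using kf_prev[OF b(1)] parent_rel_rtrancl_less[of linked kf prev v1 w] kf_prev w(1) b(2) by fastforce
    ultimately show ?thesis using b by (auto simp: I_def)
  qed
  have JW: "J \<subseteq> W" using IG linkedD goodD out_end_in_W v1 v3 unfolding J_def by auto
  have avoid: "b \<notin> J" if "b \<in> reach_avoiding A r {y1, y3}" for b
    using that
  proof (induction rule: reach_avoiding.induct)
    case root
    then show ?case using JW rW by blast
  next
    case (step b b')
    have b: "b \<notin> {y1, y3}" using reach_avoiding_notin[OF step.hyps(1)] .
    show ?case
    proof
      assume b': "b' \<in> J"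
      have "b \<in> I \<union> out_end ` I \<union> {out_end v1, out_end v3}"
      proof (cases "b' \<in> I")
        case True
        have w: "b' \<in> linked" "prev b' \<in> insert v1 I" using IG[OF True] by auto
        obtain c where c: "c \<in> linked" "prev c = b'" "c \<in> insert v3 I" using I_succ[OF True] by blast
        have "b = pf b' \<or> b = pb b'" using in_nbrs_nonspecial[OF step.hyps(2)] linkedD[OF w(1)] goodD[of b'] by blast
        then show ?thesis using linkedD[OF w(1)] linkedD[OF c(1)] w(2) c(2,3) by auto
      next
        case False
        then obtain w where w: "b' = out_end w" "w \<in> insert v1 (insert v3 I)" using b' by (auto simp: J_def)
        have "out_end w \<noteq> w"
        proof
          assume tw: "out_end w = w"
          then have "w = v1 \<or> w = v3" using False w by auto
          then show False using b' w(1) tw y by (auto simp: J_def)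
        qed
        then have "b = w" using in_nbrs_out_end step.hyps(2) w(1) by blast
        moreover have "w \<noteq> v1" "w \<noteq> v3"
          using y b' b \<open>b = w\<close> w(1) by (auto simp: J_def)
        ultimately show ?thesis using w(2) by blast
      qed
      then show False using step.IH b by (auto simp: J_def)
    qed
  qed
  have hd: "in_end y1 = v1" "in_end y2 = v2" "in_end y3 = v3"
    using y in_end_out_end goodD[OF v1] goodD[OF v2(1)] goodD[OF v3] in_end_self by auto
  have "y2 \<in> reach_avoiding A r {y1, y3}"
    using reach_avoiding_antimono[OF rule4[OF x(2)], of "{y1, y3}"] x hd ne by auto
  moreover have "y2 \<in> J" using y(2) v2(2) hd ne by (auto simp: J_def)
  ultimately show False using avoid by blast
qed

section \<open>Branch sets and the count of all vertices\<close>

definition branch_set :: "'a \<Rightarrow> 'a set" where "branch_set c = chain c \<union> out_end ` chain c"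

abbreviation sym_arcs where "sym_arcs \<equiv> A \<union> A\<inverse>"

lemma sym_sym_arcs: "sym sym_arcs" by (auto simp: sym_def)

lemma in_branch_setD: "c \<in> good \<Longrightarrow> x \<in> branch_set c \<Longrightarrow> in_end x \<in> chain c \<and> x \<notin> special"
  using chain_in_good goodD in_end_out_end unfolding branch_set_def by (fastforce simp: in_end_def)

lemma branch_set_inj: "c \<in> good - linked \<Longrightarrow> c' \<in> good - linked \<Longrightarrow> x \<in> branch_set c \<Longrightarrow> x \<in> branch_set c' \<Longrightarrow> c = c'"
  using in_branch_setD[of c x] in_branch_setD[of c' x] chain_unique[of "in_end x" c' c] by blast

lemma conn_branch_set:
  assumes c: "c \<in> good"
  shows "conn sym_arcs (branch_set c)"
proof -
  let ?R = "sym_arcs \<inter> branch_set c \<times> branch_set c"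
  have out_end: "(v, out_end v) \<in> ?R\<^sup>*" if "v \<in> chain c" for v
  proof (cases v rule: out_end_cases)
    case 2
    then have "(v, out_end v) \<in> A" using indeg1_parents(3)[OF 2(1)] by simp
    then have "(v, out_end v) \<in> ?R" using that by (auto simp: branch_set_def)
    then show ?thesis by blast
  qed simp
  have chain: "(c, v) \<in> ?R\<^sup>*" if "v \<in> chain c" for v
  proof -
    have "(c, v) \<in> chain_rel\<^sup>*" using that by (simp add: chain_def)
    then show ?thesis
    proof induction
      case (step y z)
      then have yz: "y \<in> chain c" "z \<in> chain c" by (auto simp: chain_def intro: rtrancl_into_rtrancl)
      have z: "z \<in> linked" "prev z = y" using step.hyps(2) by auto
      have "(out_end y, z) \<in> A" using pf[of z] linkedD[OF z(1)] goodD[of z] z(2) by auto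
      then have "(out_end y, z) \<in> ?R" using yz by (auto simp: branch_set_def)
      then show ?case using step.IH out_end[OF yz(1)] by (meson rtrancl.rtrancl_into_rtrancl rtrancl_trans)
    qed simp
  qed
  have from_c: "(c, x) \<in> ?R\<^sup>*" if "x \<in> branch_set c" for x
    using that chain out_end unfolding branch_set_def by (blast intro: rtrancl_trans)
  have symR: "sym (?R\<^sup>*)" by (intro sym_rtrancl) (auto simp: sym_def)
  have "(x, y) \<in> ?R\<^sup>*" if "x \<in> branch_set c" "y \<in> branch_set c" for x y
    using symD[OF symR from_c[OF that(1)]] from_c[OF that(2)] by (rule rtrancl_trans)
  moreover have "c \<in> branch_set c" by (simp add: branch_set_def chain_def)
  ultimately show ?thesis unfolding conn_def by blast
qed

text \<open>Exceptional vertices that are not special are left out; only arcs from chains to special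
  vertices have to survive in the minor.\<close>

definition branch_sets :: "'a set set" where "branch_sets = branch_set ` (good - linked) \<union> (\<lambda>x. {x}) ` special"

lemma finite_special: "finite special" using finW by (simp add: special_def)

lemma branch_family_branch_sets: "branch_family sym_arcs branch_sets"
proof -
  have "finite branch_sets" using finite_good finite_special by (simp add: branch_sets_def)
  moreover have "conn sym_arcs C" if "C \<in> branch_sets" for C
    using that conn_branch_set by (auto simp: branch_sets_def) (simp add: conn_def)
  moreover have "disjnt C C'" if "C \<in> branch_sets" "C' \<in> branch_sets" "C \<noteq> C'" for C C'
    using that branch_set_inj in_branch_setD unfolding branch_sets_def disjnt_def by fast
  ultimately show ?thesis by (auto simp: branch_family_def pairwise_def)
qed

lemma card_branch_sets_le: "card branch_sets \<le> 80 * l"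
proof -
  have "card branch_sets \<le> card (branch_set ` (good - linked)) + card ((\<lambda>x. {x}) ` special)" unfolding branch_sets_def by (rule card_Un_le)
  also have "\<dots> \<le> card (good - linked) + card special"
    using card_image_le[of "good - linked" branch_set] card_image_le[OF finite_special, of "\<lambda>x. {x}"] finite_good by simp
  finally show ?thesis using card_starts_le card_special_le by linarith
qed

text \<open>A marked vertex is charged to the branch set of its chain together with one special
  vertex that it has an arc to. By \<open>no_three_in_chain\<close> no pair is charged three
  times.\<close>

lemma card_marked_le: "card marked \<le> 2 * card (adj_pairs sym_arcs branch_sets)"
proof -
  define P where "P = (\<lambda>v c x y. c \<in> good - linked \<and> v \<in> chain c \<and> x \<in> special \<and> y \<in> {v, out_end v} \<and> (y, x) \<in> A)"
  have "\<exists>c x y. P v c x y" if v: "v \<in> marked" for v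
  proof -
    have "v \<in> good" using v by (simp add: marked_def)
    from ex_chain[OF this] obtain c where "c \<in> good - linked" "v \<in> chain c" by blast
    moreover obtain x y where "x \<in> special" "y \<in> {v, out_end v}" "(y, x) \<in> A" using v by (auto simp: marked_def)
    ultimately show ?thesis unfolding P_def by blast
  qed
  then obtain cc where "\<forall>v \<in> marked. \<exists>x y. P v (cc v) x y"
    using bchoice[of marked "\<lambda>v c. \<exists>x y. P v c x y"] by blast
  then obtain xx where "\<forall>v \<in> marked. \<exists>y. P v (cc v) (xx v) y"
    using bchoice[of marked "\<lambda>v x. \<exists>y. P v (cc v) x y"] by blast
  then obtain yy where "\<forall>v \<in> marked. P v (cc v) (xx v) (yy v)"
    using bchoice[of marked "\<lambda>v y. P v (cc v) (xx v) y"] by blast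
  then have m: "cc v \<in> good - linked" "v \<in> chain (cc v)" "xx v \<in> special" "yy v \<in> {v, out_end v}" "(yy v, xx v) \<in> A"
    if "v \<in> marked" for v
    using that unfolding P_def by blast+
  define f where "f = (\<lambda>v. (branch_set (cc v), {xx v}))"
  have fin: "finite marked" using finite_good by (simp add: marked_def)
  have "f ` marked \<subseteq> adj_pairs sym_arcs branch_sets"
  proof (rule image_subsetI)
    fix v assume v: "v \<in> marked"
    note mv = m[OF v]
    have "yy v \<in> branch_set (cc v)" using mv(2,4) by (auto simp: branch_set_def)
    moreover have "xx v \<notin> branch_set (cc v)" using in_branch_setD[of "cc v" "xx v"] mv(1,3) by blast
    ultimately have "adj sym_arcs (branch_set (cc v)) {xx v}" using mv(5) by (auto simp: adj_def)
    then show "f v \<in> adj_pairs sym_arcs branch_sets" using mv(1,3) by (simp add: adj_pairs_def f_def branch_sets_def)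
  qed
  moreover have "finite (adj_pairs sym_arcs branch_sets)"
    by (rule finite_subset[of _ "branch_sets \<times> branch_sets"]) (use finite_good finite_special in \<open>auto simp: adj_pairs_def branch_sets_def\<close>)
  ultimately have "card (f ` marked) \<le> card (adj_pairs sym_arcs branch_sets)" by (rule card_mono[rotated])
  moreover have "card marked \<le> 2 * card (f ` marked)"
  proof -
    have "card {v \<in> marked. f v = t} \<le> 2" for t
    proof (rule ccontr)
      assume "\<not> ?thesis"
      then have "3 \<le> card {v \<in> marked. f v = t}" by simp
      from obtain_subset_with_card_n[OF this]
      obtain M where M: "M \<subseteq> {v \<in> marked. f v = t}" "card M = 3" by blast
      from M(2) obtain a b c where abc: "M = {a, b, c}" "a \<noteq> b" "b \<noteq> c" "a \<noteq> c"
        unfolding card_3_iff by blast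
      have mk: "a \<in> marked" "b \<in> marked" "c \<in> marked" and f: "f a = f b" "f b = f c" using M(1) abc(1) by auto
      have x: "xx a = xx b" "xx b = xx c" and branch_set: "branch_set (cc a) = branch_set (cc b)" "branch_set (cc b) = branch_set (cc c)"
        using f by (auto simp: f_def)
      have inB: "v \<in> branch_set (cc v)" if "v \<in> marked" for v using m(2)[OF that] by (auto simp: branch_set_def)
      have "cc a = cc b" "cc b = cc c"
        using branch_set_inj m(1) mk branch_set inB by metis+
      then have chain: "a \<in> chain (cc a)" "b \<in> chain (cc a)" "c \<in> chain (cc a)"
        using m(2)[OF mk(1)] m(2)[OF mk(2)] m(2)[OF mk(3)] by simp_all
      \<comment> \<open>Any order of the three along their chain has a middle element, so all six
        orders have to be refuted.\<close>
      have no: "\<not> ((u, v) \<in> chain_rel\<^sup>* \<and> (v, w) \<in> chain_rel\<^sup>*)" if "u \<in> M" "v \<in> M" "w \<in> M" "u \<noteq> v" "v \<noteq> w" "u \<noteq> w" for u v w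
      proof
        assume "(u, v) \<in> chain_rel\<^sup>* \<and> (v, w) \<in> chain_rel\<^sup>*"
        moreover have mk': "u \<in> marked" "v \<in> marked" "w \<in> marked" using that M(1) by auto
        moreover have "xx u = xx v" "xx w = xx v" using that x abc(1) by auto
        ultimately show False
          using no_three_in_chain[of u v w "yy u" "yy v" "yy w" "xx v"] that(4-)
            m(4,5)[OF mk'(1)] m(4,5)[OF mk'(2)] m(4,5)[OF mk'(3)] by (auto simp: marked_def)
      qed
      have "\<not> ((a, b) \<in> chain_rel\<^sup>* \<and> (b, c) \<in> chain_rel\<^sup>*)" "\<not> ((a, c) \<in> chain_rel\<^sup>* \<and> (c, b) \<in> chain_rel\<^sup>*)"
        "\<not> ((b, a) \<in> chain_rel\<^sup>* \<and> (a, c) \<in> chain_rel\<^sup>*)" "\<not> ((b, c) \<in> chain_rel\<^sup>* \<and> (c, a) \<in> chain_rel\<^sup>*)"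
        "\<not> ((c, a) \<in> chain_rel\<^sup>* \<and> (a, b) \<in> chain_rel\<^sup>*)" "\<not> ((c, b) \<in> chain_rel\<^sup>* \<and> (b, a) \<in> chain_rel\<^sup>*)"
        by (rule no; use abc in force)+
      then show False
        using chain_linear[OF chain(1,2)] chain_linear[OF chain(2,3)] chain_linear[OF chain(1,3)] by argo
    qed
    then have "(\<Sum>t\<in>f ` marked. card {v \<in> marked. f v = t}) \<le> (\<Sum>t\<in>f ` marked. 2)" by (intro sum_mono) simp
    moreover have "(\<Sum>t\<in>f ` marked. card {v \<in> marked. f v = t}) = card marked"
      using sum.image_gen[OF fin, of "\<lambda>_. 1 :: nat" f] by simp
    ultimately show ?thesis by simp
  qed
  ultimately show ?thesis by linarith
qed

text \<open>Outside \<open>indeg1\<close> there are at most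
  \<open>5 * (160 * N * l + 70 * l)\<close> good vertices and \<open>70 * l\<close> others. A vertex
  of \<open>indeg1\<close> is exceptional or is mapped injectively by \<open>pf\<close> to the root
  or to a vertex outside \<open>indeg1\<close>. Doubling 420, then adding 35 and 2 for the root
  gives 877.\<close>

lemma card_V_le:
  assumes "card (adj_pairs sym_arcs branch_sets) \<le> N * card branch_sets"
  shows "card (insert r W) \<le> 877 * l + 1600 * (N * l)"
proof -
  define q where "q = N * l"
  have marked: "card marked \<le> 160 * q"
  proof -
    have "N * card branch_sets \<le> N * (80 * l)" using card_branch_sets_le by (rule mult_le_mono2)
    then have "card marked \<le> 2 * (N * (80 * l))" using card_marked_le assms by linarith
    then show ?thesis by (simp add: q_def)
  qed
  have heads: "card (W - indeg1) \<le> 420 * l + 800 * q"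
  proof -
    have "W - indeg1 \<subseteq> exceptional \<union> in_end ` exceptional \<union> good"
    proof
      fix v assume "v \<in> W - indeg1"
      then have "in_end (out_end v) = v" "v \<in> exceptional \<or> out_end v \<in> exceptional \<or> v \<in> good" using in_end_out_end by (auto simp: good_def)
      then show "v \<in> exceptional \<union> in_end ` exceptional \<union> good" by (metis UnI1 UnI2 imageI)
    qed
    then have "card (W - indeg1) \<le> card (exceptional \<union> in_end ` exceptional \<union> good)"
      using finite_exceptional finite_good by (intro card_mono) auto
    also have "\<dots> \<le> card exceptional + card (in_end ` exceptional) + card good"
      by (meson card_Un_le add_le_mono order_refl order_trans)
    also have "card (in_end ` exceptional) \<le> card exceptional" using finite_exceptional by (rule card_image_le)
    finally have "card (W - indeg1) \<le> 70 * l + card good" using card_exceptional_le by linarith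
    then show ?thesis using card_good_le marked card_starts_le by simp
  qed
  have "card indeg1 \<le> card exceptional + card (insert r (W - indeg1))"
  proof -
    have finS: "finite indeg1" using indeg1_subset finW finite_subset by blast
    have im: "pf ` (indeg1 - exceptional) \<subseteq> insert r (W - indeg1)"
    proof (rule image_subsetI)
      fix s assume "s \<in> indeg1 - exceptional"
      then have s: "s \<in> indeg1" "s \<in> W" using indeg1_subset by auto
      have "pf s \<notin> indeg1"
        using not_doms_of_indeg1[of "pf s" s] indeg1_parents(2)[OF s(1)] s(2) pf[OF s(2)] by force
      then show "pf s \<in> insert r (W - indeg1)" using parents_in_V[OF s(2)] by blast
    qed
    have "inj_on pf (indeg1 - exceptional)"
    proof (rule inj_onI)
      fix s t assume "s \<in> indeg1 - exceptional" "t \<in> indeg1 - exceptional" "pf s = pf t"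
      then show "s = t" using siblings_inj[of t pf s] indeg1_subset by (auto simp: exceptional_def)
    qed
    then have "card (indeg1 - exceptional) \<le> card (insert r (W - indeg1))"
      using im finW by (meson card_inj_on_le finite_Diff finite_insert)
    then show ?thesis using diff_card_le_card_Diff[OF finite_exceptional, of indeg1] by linarith
  qed
  moreover have "card (insert r (W - indeg1)) = Suc (card (W - indeg1))" using finW rW by simp
  moreover have "card (insert r W) = Suc (card (W - indeg1) + card indeg1)"
    using finW rW indeg1_subset card_Diff_subset[of indeg1 W] card_mono[of W indeg1] finite_subset[of indeg1 W] by auto
  ultimately show ?thesis using heads card_exceptional_le l_pos unfolding q_def[symmetric] by linarith
qed

end

section \<open>Outbranchings and minors of pair digraphs\<close>

lemma reach_avoiding_if_rtrancl_on:
  assumes "(r, v) \<in> rtrancl_on V R" "R \<subseteq> A" "V \<inter> Z = {}"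
  shows "v \<in> reach_avoiding A r Z"
  using assms(1)
proof (induction rule: rtrancl_on_induct)
  case base
  then show ?case using assms(3) by (auto intro: reach_avoiding.root)
next
  case (step y z)
  then show ?case using assms(2,3) reach_avoiding.step[of y A r Z z] by auto
qed

lemma reach_avoiding_if_pcas:
  assumes "pcas u p v" "set p \<subseteq> A" "set (pawalk_verts u p) \<inter> Z = {}" "u \<in> reach_avoiding A r Z"
  shows "v \<in> reach_avoiding A r Z"
  using assms
proof (induction p arbitrary: u)
  case (Cons e p)
  have "snd e \<in> set (pawalk_verts (snd e) p)" by (cases p) (use Cons.prems(1) in auto)
  then have "snd e \<in> reach_avoiding A r Z"
    using Cons.prems reach_avoiding.step[of u A r Z "snd e"] by (cases e) auto
  then show ?case using Cons by auto
qed simp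

lemma awalk_pair_iff:
  "pre_digraph.awalk (with_proj G) u p v \<longleftrightarrow> u \<in> pverts G \<and> set p \<subseteq> parcs G \<and> pcas u p v"
  by (simp add: pre_digraph.awalk_def cas_with_proj_eq)

lemma apath_pair_iff:
  "pre_digraph.apath (with_proj G) u p v \<longleftrightarrow>
     u \<in> pverts G \<and> set p \<subseteq> parcs G \<and> pcas u p v \<and> distinct (pawalk_verts u p)"
  by (simp add: pre_digraph.apath_def awalk_pair_iff awalk_verts_with_proj_eq)

lemma parcs_mk_symmetric_pair: "parcs (mk_symmetric (with_proj G)) = parcs G \<union> (parcs G)\<inverse>"
  by (auto simp: parcs_mk_symmetric)

lemma pawalk_verts_eq_map: "pcas u p v \<Longrightarrow> pawalk_verts u p = u # map snd p"
  by (induction p arbitrary: u) auto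

lemma pcas_snoc: "pcas u (p @ [(a, b)]) v \<longleftrightarrow> pcas u p a \<and> b = v"
  by (induction p arbitrary: u) auto

lemma pcas_nth_Suc: "pcas u p v \<Longrightarrow> Suc i < length p \<Longrightarrow> fst (p ! Suc i) = snd (p ! i)"
proof (induction p arbitrary: u i)
  case (Cons e p)
  show ?case
  proof (cases i)
    case 0
    then show ?thesis using Cons.prems by (cases p) auto
  next
    case (Suc j)
    then show ?thesis using Cons.IH[of "snd e" j] Cons.prems by simp
  qed
qed simp

lemma pcas_last: "pcas u p v \<Longrightarrow> p \<noteq> [] \<Longrightarrow> fst (p ! 0) = u \<and> snd (p ! (length p - 1)) = v"
proof (induction p arbitrary: u)
  case (Cons e p)
  show ?case
  proof (cases p)
    case (Cons e' p')
    then show ?thesis using Cons.IH[of "snd e"] Cons.prems by simp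
  qed (use Cons.prems in auto)
qed simp

lemma rtrancl_on_if_rtrancl:
  assumes "(x, y) \<in> R\<^sup>*" "R \<subseteq> V \<times> V" "R \<subseteq> R'" "x \<in> V"
  shows "(x, y) \<in> rtrancl_on V R'"
  using assms(1) by induction (use assms(2-) in \<open>auto intro: rtrancl_on_into_rtrancl_on\<close>)

section \<open>Outbranchings from parent functions\<close>

context rooted_tree
begin

definition tree_graph :: "'a pair_pre_digraph" where
  "tree_graph = \<lparr>pverts = insert r W, parcs = parent_rel W f\<rparr>"

text \<open>With the unit label the key retains only the length of the path from the root.\<close>

definition depth :: "'a \<Rightarrow> nat" where
  "depth v = length (key (\<lambda>_. ()) v)"

lemma depth_parent: "v \<in> W \<Longrightarrow> depth v = Suc (depth (f v))"
  using key_step[of v "\<lambda>_. ()"] by (simp add: depth_def)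

lemma pverts_tree_graph: "pverts tree_graph = insert r W"
  by (simp add: tree_graph_def)

lemma parcs_sym_tree: "parcs (mk_symmetric (with_proj tree_graph)) = parent_rel W f \<union> (parent_rel W f)\<inverse>"
  by (simp add: parcs_mk_symmetric_pair tree_graph_def)

lemma connected_tree_graph: "Digraph_Component.connected (with_proj tree_graph)"
proof -
  let ?R = "parent_rel W f \<union> (parent_rel W f)\<inverse>"
  have sub: "?R \<subseteq> insert r W \<times> insert r W" using f unfolding parent_rel_def by blast
  have root: "(r, v) \<in> ?R\<^sup>*" "(v, r) \<in> ?R\<^sup>*" if v: "v \<in> insert r W" for v
  proof -
    have rv: "(r, v) \<in> (parent_rel W f)\<^sup>*" using root_anc v .
    then show "(r, v) \<in> ?R\<^sup>*" by (meson Un_upper1 in_mono rtrancl_mono)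
    have "(v, r) \<in> ((parent_rel W f)\<inverse>)\<^sup>*" using rv by (rule rtrancl_converseI)
    then show "(v, r) \<in> ?R\<^sup>*" by (meson Un_upper2 in_mono rtrancl_mono)
  qed
  have "(u, v) \<in> rtrancl_on (insert r W) ?R" if "u \<in> insert r W" "v \<in> insert r W" for u v
  proof (rule rtrancl_on_if_rtrancl)
    show "(u, v) \<in> ?R\<^sup>*" using root(2)[OF that(1)] root(1)[OF that(2)] by (rule rtrancl_trans)
  qed (use sub that in auto)
  then show ?thesis
    unfolding connected_def strongly_connected_def reachable_def
    by (simp add: parcs_sym_tree pverts_tree_graph)
qed

text \<open>At a vertex of maximal depth on the cycle both cyclic neighbours would be its parent;
  they are distinct positions once the length is at least 3.\<close>

lemma no_long_cycle:
  assumes "pre_digraph.cycle (with_proj (mk_symmetric (with_proj tree_graph))) p"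
  shows "length p < 3"
proof (rule ccontr)
  assume n3: "\<not> length p < 3"
  let ?R = "parent_rel W f \<union> (parent_rel W f)\<inverse>"
  define n where "n = length p"
  obtain u where p: "set p \<subseteq> ?R" "pcas u p u" and dist: "distinct (map snd p)"
    using assms unfolding pre_digraph.cycle_def awalk_pair_iff awalk_verts_with_proj_eq parcs_sym_tree
    by (auto simp: pawalk_verts_eq_map)
  have pn: "p \<noteq> []" using n3 by auto
  have cyc: "fst (p ! (if Suc i = n then 0 else Suc i)) = snd (p ! i)" if "i < n" for i
  proof (cases "Suc i = n")
    case True
    then have "i = length p - 1" by (simp add: n_def)
    then show ?thesis using pcas_last[OF p(2) pn] True by simp
  qed (use that pcas_nth_Suc[OF p(2), of i] in \<open>simp add: n_def\<close>)
  have "\<forall>i. i < n \<longrightarrow> depth (snd (p ! i)) < Suc (Max ((\<lambda>i. depth (snd (p ! i))) ` {..<n}))"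
    by (auto simp: less_Suc_eq_le)
  moreover have "0 < n" using pn by (simp add: n_def)
  ultimately obtain i where i: "i < n" and max: "\<And>j. j < n \<Longrightarrow> depth (snd (p ! j)) \<le> depth (snd (p ! i))"
    using ex_has_greatest_nat[of "\<lambda>i. i < n" 0 "\<lambda>i. depth (snd (p ! i))"] by blast
  define j where "j = (if Suc i = n then 0 else Suc i)"
  define k where "k = (if i = 0 then n - 1 else i - 1)"
  have jk: "j < n" "k < n" "j \<noteq> k" using i n3 by (auto simp: j_def k_def n_def)
  have nb: "x = f y" if xy: "(x, y) \<in> ?R" and "depth x \<le> depth y" for x y
    using xy that(2) depth_parent by auto
  have "p ! j \<in> ?R" "p ! i \<in> ?R" using p(1) nth_mem[of j p] nth_mem[of i p] jk(1) i unfolding n_def by blast+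
  moreover have "fst (p ! j) = snd (p ! i)" using cyc[OF i] by (simp add: j_def)
  moreover have "fst (p ! i) = snd (p ! k)" using cyc[OF jk(2)] i by (auto simp: k_def split: if_splits)
  ultimately have R: "(snd (p ! i), snd (p ! j)) \<in> ?R" "(snd (p ! k), snd (p ! i)) \<in> ?R"
    by (metis prod.collapse)+
  then have "(snd (p ! j), snd (p ! i)) \<in> ?R" by blast
  then have "snd (p ! j) = f (snd (p ! i))" using nb max[OF jk(1)] by blast
  moreover have "snd (p ! k) = f (snd (p ! i))" using nb R(2) max[OF jk(2)] by blast
  ultimately have "map snd p ! j = map snd p ! k" using jk by (simp add: n_def)
  then show False using nth_eq_iff_index_eq[OF dist, of j k] jk by (simp add: n_def)
qed

text \<open>The depth bound is carried through the induction because it shows that the vertex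
  appended is new.\<close>

lemma apath_from_root:
  assumes "v \<in> insert r W"
  shows "\<exists>p. pcas r p v \<and> set p \<subseteq> parent_rel W f \<and> distinct (pawalk_verts r p) \<and>
    (\<forall>x \<in> set (pawalk_verts r p). depth x \<le> depth v) \<and> (v \<in> W \<longrightarrow> (\<exists>q. p = q @ [(f v, v)]))"
  using assms
proof (induction v rule: key_induct)
  case root
  show ?case using r by (intro exI[of _ "[]"]) auto
next
  case (child v)
  then obtain p where p: "pcas r p (f v)" "set p \<subseteq> parent_rel W f" "distinct (pawalk_verts r p)"
    "\<forall>x \<in> set (pawalk_verts r p). depth x \<le> depth (f v)" by blast
  have c: "pcas r (p @ [(f v, v)]) v" using p(1) by (simp add: pcas_snoc)
  have verts: "pawalk_verts r (p @ [(f v, v)]) = pawalk_verts r p @ [v]"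
    using pawalk_verts_eq_map[OF c] pawalk_verts_eq_map[OF p(1)] by simp
  have "v \<notin> set (pawalk_verts r p)" using p(4) depth_parent[OF child(1)] by auto
  then show ?case
    using p c child(1) depth_parent[OF child(1)] by (intro exI[of _ "p @ [(f v, v)]"]) (auto simp: verts)
qed

lemma outbranching_tree_graph:
  assumes "pair_digraph D" "insert r W = pverts D" "parent_rel W f \<subseteq> parcs D"
  shows "outbranching D r tree_graph"
proof -
  interpret D: pair_digraph D by fact
  have "fst e \<in> pverts tree_graph \<and> snd e \<in> pverts tree_graph" if "e \<in> parcs tree_graph" for e
    using that f[of "snd e"] by (cases e) (auto simp: tree_graph_def)
  then have "pair_wf_digraph tree_graph" by unfold_locales blast+
  then have "wf_digraph (with_proj tree_graph)" by (simp add: wf_digraph_wp_iff)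
  moreover have "wf_digraph (with_proj D)" by unfold_locales
  ultimately have "spanning (with_proj tree_graph) (with_proj D)"
    using assms(2,3) by (simp add: spanning_def subgraph_def compatible_def tree_graph_def)
  moreover have "underlying_tree tree_graph"
    unfolding underlying_tree_def using connected_tree_graph no_long_cycle by fastforce
  moreover have "\<exists>p. pre_digraph.apath (with_proj (mk_symmetric (with_proj tree_graph))) r (p @ [(u, v)]) v"
    if "(u, v) \<in> parcs tree_graph" for u v
  proof -
    have v: "v \<in> W" "u = f v" using that by (auto simp: tree_graph_def)
    then obtain q where "pcas r (q @ [(u, v)]) v" "set (q @ [(u, v)]) \<subseteq> parent_rel W f"
      "distinct (pawalk_verts r (q @ [(u, v)]))"
      using apath_from_root[of v] by blast
    then show ?thesis
      unfolding apath_pair_iff parcs_sym_tree by (intro exI[of _ q]) (auto simp: tree_graph_def)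
  qed
  ultimately show ?thesis unfolding outbranching_def by blast
qed

lemma leaves_tree_graph: "leaves tree_graph = insert r W - f ` W"
proof -
  have "out_degree (with_proj tree_graph) v = 0 \<longleftrightarrow> v \<notin> f ` W" for v
  proof -
    have "out_arcs (with_proj tree_graph) v = {(v, w) | w. w \<in> W \<and> f w = v}"
      by (auto simp: out_arcs_def tree_graph_def)
    moreover have "finite {(v, w) | w. w \<in> W \<and> f w = v}"
      by (rule finite_subset[of _ "{v} \<times> W"]) (use fin in auto)
    ultimately show ?thesis by (auto simp: out_degree_def)
  qed
  then show ?thesis by (auto simp: leaves_def tree_graph_def)
qed

end

text \<open>The point is that the set under \<open>Max\<close> is finite: no leaf count exceeds the
  number of vertices.\<close>

lemma card_leaves_le_maxleaf:
  assumes "finite (pverts D)" "outbranching D r T"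
  shows "card (leaves T) \<le> maxleaf D r"
proof -
  have "card (leaves T') \<le> card (pverts D)" if "outbranching D r T'" for T'
  proof -
    have "pverts T' = pverts D" using that by (simp add: outbranching_def spanning_def)
    then have "leaves T' \<subseteq> pverts D" by (auto simp: leaves_def)
    then show ?thesis using assms(1) by (simp add: card_mono)
  qed
  then have "{card (leaves T) | T. outbranching D r T} \<subseteq> {..card (pverts D)}" by blast
  then have "finite {card (leaves T) | T. outbranching D r T}" using finite_atMost by (rule finite_subset)
  then show ?thesis unfolding maxleaf_def by (rule Max_ge) (use assms(2) in blast)
qed

section \<open>Minors from branch sets, and the main bound\<close>

lemma connected_induced_if_conn:
  assumes "conn (parcs G) B"
  shows "Digraph_Component.connected (with_proj G \<restriction> B)"
proof -
  have "(x, y) \<in> rtrancl_on B (parcs (mk_symmetric (with_proj G \<restriction> B)))" if "x \<in> B" "y \<in> B" for x y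
  proof (rule rtrancl_on_if_rtrancl)
    show "(x, y) \<in> (parcs G \<inter> B \<times> B)\<^sup>*" using assms that by (simp add: conn_def)
    show "parcs G \<inter> B \<times> B \<subseteq> parcs (mk_symmetric (with_proj G \<restriction> B))"
      by (force simp: parcs_mk_symmetric)
  qed (use that in auto)
  then show ?thesis using assms
    unfolding connected_def strongly_connected_def reachable_def by (auto simp: conn_def)
qed

text \<open>As the branch sets are pairwise adjacent, any bijection from the vertices of
  \<open>H\<close> to them works.\<close>

lemma is_minor_if_branch_family:
  assumes H: "pair_graph H" and C: "branch_family (parcs G) C" "card C = card (pverts H)"
    "pairwise (adj (parcs G)) C" "\<Union>C \<subseteq> pverts G"
  shows "is_minor H G"
proof -
  interpret H: pair_graph H by fact
  have "finite C" using C(1) by (simp add: branch_family_def)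
  then obtain B where B: "bij_betw B (pverts H) C"
    using finite_same_card_bij[of "pverts H" C] H.pair_finite_verts C(2) by metis
  have BC: "B x \<in> C" if "x \<in> pverts H" for x using B that by (auto simp: bij_betw_def)
  have ne: "B x \<noteq> B y" if "x \<in> pverts H" "y \<in> pverts H" "x \<noteq> y" for x y
    using B that by (auto simp: bij_betw_def inj_on_def)
  show ?thesis
    unfolding is_minor_def
  proof (intro exI[of _ B] conjI ballI impI)
    fix x assume x: "x \<in> pverts H"
    show "B x \<subseteq> pverts G" using BC[OF x] C(4) by blast
    show "Digraph_Component.connected (with_proj G \<restriction> B x)"
      using BC[OF x] C(1) by (intro connected_induced_if_conn) (simp add: branch_family_def)
  next
    fix x y assume "x \<in> pverts H" "y \<in> pverts H" "x \<noteq> y"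
    then show "B x \<inter> B y = {}" using BC ne C(1) by (auto simp: branch_family_def pairwise_def disjnt_def)
  next
    fix e assume e: "e \<in> parcs H"
    obtain x y where xy: "e = (x, y)" by (cases e)
    have "x \<in> pverts H" "y \<in> pverts H" "x \<noteq> y"
      using e xy H.in_arcsD1 H.in_arcsD2 H.no_loops' by blast+
    then have "adj (parcs G) (B x) (B y)" using BC ne C(3) by (auto simp: pairwise_def)
    then show "case e of (x, y) \<Rightarrow> \<exists>u \<in> B x. \<exists>v \<in> B y. (u, v) \<in> parcs G" using xy by (auto simp: adj_def)
  qed
qed

lemma (in pair_digraph) out_degree_eq_card: "out_degree (with_proj G) v = card {w. (v, w) \<in> parcs G}"
proof -
  have "out_arcs (with_proj G) v = Pair v ` {w. (v, w) \<in> parcs G}" by (auto simp: out_arcs_def)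
  then show ?thesis by (simp add: out_degree_def card_image inj_on_def)
qed

lemma card_verts_le:
  assumes D: "rooted_digraph D r" "reduced D r" and H: "pair_graph H"
    and minor: "\<not> is_minor H (mk_symmetric (with_proj D))"
  shows "card (pverts D) \<le> 4096 * 2 ^ card (pverts H) * maxleaf D r"
proof -
  define A where "A = parcs D"
  define W where "W = pverts D - {r}"
  define l where "l = maxleaf D r"
  define h where "h = card (pverts H)"
  interpret D: pair_digraph D using D(1) by (simp add: rooted_digraph_def)
  have rV: "r \<in> pverts D" and in0: "in_degree (with_proj D) r = 0" using D(1) by (simp_all add: rooted_digraph_def)
  have V: "insert r W = pverts D" using rV by (auto simp: W_def)
  have finA: "finite A" using D.pair_finite_arcs by (simp add: A_def)
  have no_in: "(u, r) \<notin> A" for u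
  proof
    assume "(u, r) \<in> A"
    then have "(u, r) \<in> in_arcs (with_proj D) r" by (simp add: A_def)
    moreover have "finite (in_arcs (with_proj D) r)" using finA by (simp add: in_arcs_def A_def)
    ultimately show False using in0 unfolding in_degree_def by (metis card_0_eq empty_iff)
  qed
  have finW: "finite W" using D.pair_finite_verts by (simp add: W_def)
  have rW: "r \<notin> W" by (simp add: W_def)
  have AW: "u \<in> insert r W \<and> v \<in> W" if "(u, v) \<in> A" for u v
    using that no_in D.in_arcsD1 D.in_arcsD2 V by (auto simp: A_def W_def)
  have rules: "rule1 D r" "rule2 D r" "rule3 D" "rule4 D r" using D(2) by (simp_all add: reduced_def)
  interpret R: reduced_flow_graph W r A
  proof
    show "(v, v) \<notin> A" for v using D.no_loops' by (auto simp: A_def)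
    fix v assume "v \<in> insert r W"
    then have "(r, v) \<in> rtrancl_on (pverts D) (parcs D)"
      using rules(1) V by (auto simp: rule1_def reachable_def)
    then show "v \<in> reach_avoiding A r {}" by (rule reach_avoiding_if_rtrancl_on) (auto simp: A_def)
  next
    fix y x assume yx: "(y, x) \<in> A"
    have "x \<in> pverts D" "y \<in> in_nbrs D x" using AW[OF yx] V yx by (auto simp: in_nbrs_def A_def)
    then obtain p where p: "pre_digraph.apath (with_proj D) r p y"
      "set (pre_digraph.awalk_verts (with_proj D) r p) \<inter> (in_nbrs D x - {y}) = {}"
      using rules(4) unfolding rule4_def by blast
    have pc: "pcas r p y" "set p \<subseteq> A" and av: "set (pawalk_verts r p) \<inter> ({u. (u, x) \<in> A} - {y}) = {}"
      using p by (auto simp: apath_pair_iff awalk_verts_with_proj_eq in_nbrs_def A_def)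
    have "r \<in> set (pawalk_verts r p)" by (cases p) (use pc(1) in auto)
    then have "r \<in> reach_avoiding A r ({u. (u, x) \<in> A} - {y})" using av by (auto intro: reach_avoiding.root)
    with pc av show "y \<in> reach_avoiding A r ({u. (u, x) \<in> A} - {y})" by (rule reach_avoiding_if_pcas)
  qed (use finW rW AW in blast)+
  interpret FL: few_leaves W r A l
  proof
    fix f assume f: "\<And>v. v \<in> W \<Longrightarrow> (f v, v) \<in> A" and acyc: "acyclic (parent_rel W f)"
    interpret T: rooted_tree W r f by standard (use finW rW f AW acyc in blast)+
    have "outbranching D r T.tree_graph"
      by (rule T.outbranching_tree_graph) (use f V in \<open>auto simp: A_def D.pair_digraph\<close>)
    then have "card (leaves T.tree_graph) \<le> l"
      unfolding l_def by (rule card_leaves_le_maxleaf[OF D.pair_finite_verts])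
    then show "card (insert r W - f ` W) \<le> l" by (simp add: T.leaves_tree_graph)
  qed (use finW rW AW in blast)+
  have cut: "in_degree (with_proj D) p \<noteq> 1 \<and> out_degree (with_proj D) p \<noteq> 1"
    if "R.doms p w" "w \<noteq> p" "p \<in> W" "w \<in> W" for p w
  proof -
    have "\<not> r \<rightarrow>\<^sup>*\<^bsub>pre_digraph.del_vert (with_proj D) p\<^esub> w"
    proof
      assume "r \<rightarrow>\<^sup>*\<^bsub>pre_digraph.del_vert (with_proj D) p\<^esub> w"
      then have "(r, w) \<in> rtrancl_on (pverts D - {p}) (arcs_ends (pre_digraph.del_vert (with_proj D) p))"
        by (simp add: reachable_def pre_digraph.verts_del_vert)
      moreover have "arcs_ends (pre_digraph.del_vert (with_proj D) p) \<subseteq> A"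
        by (auto simp: arcs_ends_def arc_to_ends_def pre_digraph.del_vert_def A_def)
      ultimately have "w \<in> reach_avoiding A r {p}" by (rule reach_avoiding_if_rtrancl_on) auto
      then show False using that(1) by (simp add: R.doms_def)
    qed
    then have "cut_vertex D r p" using that by (auto simp: cut_vertex_def W_def)
    then show ?thesis using rules(2) by (auto simp: rule2_def)
  qed
  obtain kf kg :: "'a \<Rightarrow> real list" where order:
    "\<And>u v. u \<in> insert r W \<Longrightarrow> v \<in> insert r W \<Longrightarrow> R.doms u v \<longleftrightarrow> kf u \<le> kf v \<and> kg u \<le> kg v"
    and inj: "inj_on kf (insert r W)" "inj_on kg (insert r W)"
    and low: "\<And>v. v \<in> W - R.indeg1 \<Longrightarrow> \<exists>u. (u, v) \<in> A \<and> kf u < kf v"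
    and high: "\<And>v. v \<in> W - R.indeg1 \<Longrightarrow> \<exists>u. (u, v) \<in> A \<and> kg u < kg v"
    using R.low_high_order by blast
  \<comment> \<open>The only in-neighbour of such a vertex dominates it and so precedes it in both
    orders, strictly by injectivity.\<close>
  have S_less: "\<exists>u. (u, v) \<in> A \<and> kf u < kf v \<and> kg u < kg v" if v: "v \<in> R.indeg1" for v
  proof -
    obtain u where u: "(u, v) \<in> A" using v by (auto simp: R.indeg1_def)
    then have "R.doms u v" using R.indeg1_parent v by blast
    moreover have "u \<in> insert r W" "v \<in> insert r W" "u \<noteq> v" using AW[OF u] R.irrefl u by auto
    ultimately have "kf u < kf v" "kg u < kg v"
      using order inj unfolding inj_on_def by (metis order_le_imp_less_or_eq)+
    then show ?thesis using u by blast
  qed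
  define pf where "pf = (\<lambda>v. SOME u. (u, v) \<in> A \<and> kf u < kf v)"
  define pb where "pb = (\<lambda>v. SOME u. (u, v) \<in> A \<and> kg u < kg v)"
  have pf: "(pf v, v) \<in> A \<and> kf (pf v) < kf v" if "v \<in> W" for v
    using someI_ex[of "\<lambda>u. (u, v) \<in> A \<and> kf u < kf v"] low[of v] S_less[of v] that unfolding pf_def by blast
  have pb: "(pb v, v) \<in> A \<and> kg (pb v) < kg v" if "v \<in> W" for v
    using someI_ex[of "\<lambda>u. (u, v) \<in> A \<and> kg u < kg v"] high[of v] S_less[of v] that unfolding pb_def by blast
  interpret T: two_trees_rule3 W r A l kf kg pf pb
  proof
    fix p w assume pw: "R.doms p w" "w \<noteq> p" "p \<in> W" "w \<in> W"
    show "p \<notin> R.indeg1"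
    proof
      assume "p \<in> R.indeg1"
      then obtain u where u: "\<And>u'. (u', p) \<in> A \<longleftrightarrow> u' = u" unfolding R.indeg1_def by blast
      have "in_arcs (with_proj D) p = {(u, p)}"
      proof (rule set_eqI)
        show "e \<in> in_arcs (with_proj D) p \<longleftrightarrow> e \<in> {(u, p)}" for e
          using u[of "fst e"] by (cases e) (auto simp: A_def)
      qed
      then show False using cut[OF pw] by (simp add: in_degree_def)
    qed
    show "card {z. (p, z) \<in> A} \<noteq> 1" using cut[OF pw] D.out_degree_eq_card by (simp add: A_def)
  next
    fix u :: "nat \<Rightarrow> 'a"
    assume "inj_on u {1..5}" "u ` {1..5} \<subseteq> insert r W"
      "\<And>i. i \<in> {2, 3, 4} \<Longrightarrow> {z. (u i, z) \<in> A} = {u (i - 1), u (i + 1)} \<and> {z. (z, u i) \<in> A} = {u (i - 1), u (i + 1)}"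
    then have "u ` {1..5} \<subseteq> pverts D \<and> inj_on u {1..5} \<and>
      (\<forall>i \<in> {2, 3, 4}. out_nbrs D (u i) = {u (i - 1), u (i + 1)} \<and> in_nbrs D (u i) = {u (i - 1), u (i + 1)})"
      unfolding V A_def out_nbrs_def in_nbrs_def by blast
    then show False using rules(3) unfolding rule3_def by blast
  qed (use order pf pb in blast)+
  have E: "parcs (mk_symmetric (with_proj D)) = A \<union> A\<inverse>" by (simp add: parcs_mk_symmetric_pair A_def)
  have "card (adj_pairs (A \<union> A\<inverse>) T.branch_sets) \<le> 2 ^ h * card T.branch_sets"
  proof (rule ccontr)
    assume dense: "\<not> ?thesis"
    then have "T.branch_sets \<noteq> {}" by (auto simp: adj_pairs_def)
    then obtain C where C: "complete_model (A \<union> A\<inverse>) T.branch_sets h C"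
      using complete_model_if_dense[OF T.sym_sym_arcs T.branch_family_branch_sets, of h] dense by force
    have "\<Union>T.branch_sets \<subseteq> pverts D"
      using T.chain_in_good T.goodD T.special_def V unfolding T.branch_sets_def T.branch_set_def by blast
    moreover have "\<forall>X \<in> C. X \<subseteq> \<Union>T.branch_sets" using C by (simp add: complete_model_def)
    ultimately have sub: "\<Union>C \<subseteq> pverts (mk_symmetric (with_proj D))"
      unfolding pverts_mk_symmetric with_proj_simps by blast
    have "is_minor H (mk_symmetric (with_proj D))"
      using C sub unfolding complete_model_def h_def
      by (intro is_minor_if_branch_family[OF H, where C = C]) (simp_all only: E)
    then show False using minor by blast
  qed
  from T.card_V_le[OF this] have "card (pverts D) \<le> 877 * l + 1600 * (2 ^ h * l)" by (simp add: V)
  \<comment> \<open>877 + 1600 is rounded up to 4096 = 2 ^ 12, a power of two for the exponent of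
    the theorem.\<close>
  moreover have "l \<le> 2 ^ h * l" by simp
  ultimately have "card (pverts D) \<le> 4096 * (2 ^ h * l)" by linarith
  then show ?thesis by (simp add: l_def h_def)
qed

text \<open>For \<open>H\<close> this small the factor \<open>sqrt (log 2 h)\<close> does not reach
  1; but no digraph with a root excludes such an \<open>H\<close>.\<close>

lemma is_minor_if_card_le_1:
  assumes H: "pair_graph H" and h: "card (pverts H) \<le> 1" and r: "r \<in> pverts G"
  shows "is_minor H G"
proof (cases "card (pverts H) = 0")
  case True
  then show ?thesis
    by (intro is_minor_if_branch_family[OF H, of _ "{}"]) (auto simp: branch_family_def)
next
  case False
  then show ?thesis using h r
    by (intro is_minor_if_branch_family[OF H, of _ "{{r}}"]) (auto simp: branch_family_def conn_def)
qed

theorem theorem34: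
  shows "\<exists>(c :: 'h pair_pre_digraph \<Rightarrow> real) (C :: real).
    \<forall>H :: 'h pair_pre_digraph. pair_graph H \<longrightarrow>
      c H \<le> 2 powr (C * (real (card (pverts H)) * sqrt (log 2 (real (card (pverts H)))))) \<and>
      (\<forall>(D :: 'a pair_pre_digraph) (r :: 'a) (k :: nat).
         rooted_digraph D r \<longrightarrow> \<not> is_minor H (mk_symmetric D) \<longrightarrow> reduced D r \<longrightarrow>
         maxleaf D r < k \<longrightarrow> real (card (pverts D)) \<le> c H * real k)"
proof (intro exI allI impI conjI)
  \<comment> \<open>13 = 12 + 1: the factor 4096 and the factor \<open>2 ^ h\<close> contribute
    \<open>12 + h\<close> to the exponent, which is at most \<open>13 * h\<close>, and the square
    root is at least 1 for \<open>h \<ge> 2\<close>.\<close>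
  let ?c = "\<lambda>H :: 'h pair_pre_digraph. 2 powr (13 * (real (card (pverts H)) * sqrt (log 2 (real (card (pverts H))))))"
  fix H :: "'h pair_pre_digraph" assume H: "pair_graph H"
  show "?c H \<le> ?c H" by simp
  fix D :: "'a pair_pre_digraph" and r k
  assume D: "rooted_digraph D r" "reduced D r" and minor: "\<not> is_minor H (mk_symmetric (with_proj D))"
    and k: "maxleaf D r < k"
  define h where "h = card (pverts H)"
  have "r \<in> pverts (mk_symmetric (with_proj D))" using D(1) by (simp add: rooted_digraph_def)
  then have "\<not> h \<le> 1" using is_minor_if_card_le_1[OF H, of r "mk_symmetric (with_proj D)"] minor
    unfolding h_def by metis
  then have h2: "2 \<le> h" by simp
  then have "1 \<le> sqrt (log 2 (real h))" by (simp add: le_log_iff)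
  then have "real h * 1 \<le> real h * sqrt (log 2 (real h))" by (rule mult_left_mono) simp
  then have "12 + real h \<le> 13 * (real h * sqrt (log 2 (real h)))" using h2 by linarith
  then have "2 powr (12 + real h) \<le> ?c H" unfolding h_def by simp
  moreover have "2 powr (12 + real h) = 4096 * 2 ^ h" by (simp add: powr_add powr_realpow)
  ultimately have c: "4096 * 2 ^ h \<le> ?c H" by simp
  have "real (card (pverts D)) \<le> real (4096 * 2 ^ h * maxleaf D r)"
    using card_verts_le[OF D H minor] unfolding h_def by (rule of_nat_mono)
  also have "\<dots> = 4096 * 2 ^ h * real (maxleaf D r)" by simp
  also have "\<dots> \<le> ?c H * real k" using c k by (intro mult_mono) auto
  finally show "real (card (pverts D)) \<le> ?c H * real k" .
qed

end
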